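(* Let $X$ be a topological space. Then the functor $U\mapsto\Pi_1(U)$ from $\mathfrak{Off}(X)$ to the category $\mathsf{Grp}$ of small groupoids (where $\Pi_1(U)$ is the fundamental groupoid of $U$ and inclusions of open sets induce the evident functors) is simultaneously a cosheaf and a costack with values in $\mathsf{Grp}$.
   Context: $\mathfrak{Off}(X)$ is the poset of open subsets of $X$ viewed as a category. $\Pi_1(U)$ has as objects the points of $U$ and as morphisms the homotopy classes (rel endpoints) of paths in $U$. A functor $\mathcal{G}:\mathfrak{Off}(X)\to\mathsf{Grp}$ is a cosheaf if for every open $U$ and every open covering $U=\bigcup_iU_i$, the functor $\coprod_i\mathcal{G}(U_i)\to\mathcal{G}(U)$ exhibits $\mathcal{G}(U)$ as the coequaliser, in the category of small groupoids, of the two functors $\coprod_{i,j}\mathcal{G}(U_i\cap U_j)\rightrightarrows\coprod_i\mathcal{G}(U_i)$ induced by the inclusions. $\mathcal{G}$ is a costack if for every groupoid $\mathsf{D}$, every open $U$ and every open covering $U=\bigcup_iU_i$, the canonical functor from $\mathrm{Hom}_{\mathsf{Grp}}(\mathcal{G}(U),\mathsf{D})$ to the descent groupoid is an equivalence of groupoids; here $\mathrm{Hom}_{\mathsf{Grp}}(\mathsf{A},\mathsf{D})$ is the groupoid of functors and natural transformations, for $V\subseteq W$ and $f:\mathcal{G}(W)\to\mathsf{D}$ we write $f|_V$ for $f$ composed with $\mathcal{G}(V)\to\mathcal{G}(W)$, $U_{ij}=U_i\cap U_j$, $U_{ijk}=U_i\cap U_j\cap U_k$, the descent groupoid has objects the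 data $(f_i,\phi_{ij})$ with $f_i:\mathcal{G}(U_i)\to\mathsf{D}$ functors and $\phi_{ij}:f_i|_{U_{ij}}\Rightarrow f_j|_{U_{ij}}$ natural isomorphisms satisfying $\phi_{jk}|_{U_{ijk}}\circ\phi_{ij}|_{U_{ijk}}=\phi_{ik}|_{U_{ijk}}$ for all $i,j,k$, morphisms $(f_i,\phi_{ij})\to(g_i,\psi_{ij})$ are families of natural transformations $\theta_i:f_i\Rightarrow g_i$ with $\psi_{ij}\circ\theta_i|_{U_{ij}}=\theta_j|_{U_{ij}}\circ\phi_{ij}$, and the canonical functor sends $f$ to $(f|_{U_i},\mathrm{id})$. (Equivalently, $\mathcal{G}(U)$ is the 2-colimit of the diagram $\coprod_{i,j,k}\mathcal{G}(U_{ijk})\rightrightarrows\!\!\!\!\to\coprod_{i,j}\mathcal{G}(U_{ij})\rightrightarrows\coprod_i\mathcal{G}(U_i)$.) *)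

theory Defs
  imports "HOL-Analysis.Analysis"
begin

record ('o, 'm) grpd =
  g_obj :: "'o set"
  g_arr :: "'m set"
  g_dom :: "'m \<Rightarrow> 'o"
  g_cod :: "'m \<Rightarrow> 'o"
  g_id  :: "'o \<Rightarrow> 'm"
  g_comp :: "'m \<Rightarrow> 'm \<Rightarrow> 'm"

definition is_groupoid :: "('o, 'm) grpd \<Rightarrow> bool" where
  "is_groupoid A \<longleftrightarrow>
     (\<forall>f\<in>g_arr A. g_dom A f \<in> g_obj A \<and> g_cod A f \<in> g_obj A) \<and>
     (\<forall>x\<in>g_obj A. g_id A x \<in> g_arr A \<and> g_dom A (g_id A x) = x \<and> g_cod A (g_id A x) = x) \<and>
     (\<forall>f\<in>g_arr A. \<forall>g\<in>g_arr A. g_cod A f = g_dom A g \<longrightarrow>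
        g_comp A g f \<in> g_arr A \<and> g_dom A (g_comp A g f) = g_dom A f \<and>
        g_cod A (g_comp A g f) = g_cod A g) \<and>
     (\<forall>f\<in>g_arr A. g_comp A (g_id A (g_cod A f)) f = f \<and> g_comp A f (g_id A (g_dom A f)) = f) \<and>
     (\<forall>f\<in>g_arr A. \<forall>g\<in>g_arr A. \<forall>h\<in>g_arr A.
        g_cod A f = g_dom A g \<longrightarrow> g_cod A g = g_dom A h \<longrightarrow>
        g_comp A h (g_comp A g f) = g_comp A (g_comp A h g) f) \<and>
     (\<forall>f\<in>g_arr A. \<exists>g\<in>g_arr A. g_dom A g = g_cod A f \<and> g_cod A g = g_dom A f \<and>
        g_comp A g f = g_id A (g_dom A f) \<and> g_comp A f g = g_id A (g_cod A f))"

text \<open>A functor is a pair (object map, arrow map); only its values on the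
  carriers matter.\<close>

type_synonym ('o1, 'm1, 'o2, 'm2) gfun = "('o1 \<Rightarrow> 'o2) \<times> ('m1 \<Rightarrow> 'm2)"

definition is_functor :: "('o1, 'm1) grpd \<Rightarrow> ('o2, 'm2) grpd \<Rightarrow> ('o1, 'm1, 'o2, 'm2) gfun \<Rightarrow> bool" where
  "is_functor A B F \<longleftrightarrow>
     (\<forall>x\<in>g_obj A. fst F x \<in> g_obj B) \<and>
     (\<forall>f\<in>g_arr A. snd F f \<in> g_arr B \<and> g_dom B (snd F f) = fst F (g_dom A f) \<and>
        g_cod B (snd F f) = fst F (g_cod A f)) \<and>
     (\<forall>x\<in>g_obj A. snd F (g_id A x) = g_id B (fst F x)) \<and>
     (\<forall>f\<in>g_arr A. \<forall>g\<in>g_arr A. g_cod A f = g_dom A g \<longrightarrow>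
        snd F (g_comp A g f) = g_comp B (snd F g) (snd F f))"

definition fcomp :: "('o2, 'm2, 'o3, 'm3) gfun \<Rightarrow> ('o1, 'm1, 'o2, 'm2) gfun \<Rightarrow> ('o1, 'm1, 'o3, 'm3) gfun" where
  "fcomp G F = (fst G \<circ> fst F, snd G \<circ> snd F)"

definition fident :: "('o, 'm, 'o, 'm) gfun" where
  "fident = (id, id)"

definition feq :: "('o1, 'm1) grpd \<Rightarrow> ('o1, 'm1, 'o2, 'm2) gfun \<Rightarrow> ('o1, 'm1, 'o2, 'm2) gfun \<Rightarrow> bool" where
  "feq A F G \<longleftrightarrow> (\<forall>x\<in>g_obj A. fst F x = fst G x) \<and> (\<forall>f\<in>g_arr A. snd F f = snd G f)"

definition frestr :: "('o1, 'm1) grpd \<Rightarrow> ('o1, 'm1, 'o2, 'm2) gfun \<Rightarrow> ('o1, 'm1, 'o2, 'm2) gfun" where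
  "frestr A F = (restrict (fst F) (g_obj A), restrict (snd F) (g_arr A))"

definition is_nat :: "('o1, 'm1) grpd \<Rightarrow> ('o2, 'm2) grpd \<Rightarrow> ('o1, 'm1, 'o2, 'm2) gfun \<Rightarrow>
    ('o1, 'm1, 'o2, 'm2) gfun \<Rightarrow> ('o1 \<Rightarrow> 'm2) \<Rightarrow> bool" where
  "is_nat A B F G \<theta> \<longleftrightarrow>
     (\<forall>x\<in>g_obj A. \<theta> x \<in> g_arr B \<and> g_dom B (\<theta> x) = fst F x \<and> g_cod B (\<theta> x) = fst G x) \<and>
     (\<forall>f\<in>g_arr A. g_comp B (\<theta> (g_cod A f)) (snd F f) = g_comp B (snd G f) (\<theta> (g_dom A f)))"

text \<open>Equivalence of groupoids: a functor admitting a quasi-inverse, i.e. a functor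
  in the other direction with natural isomorphisms to the identities (in a
  groupoid every natural transformation is a natural isomorphism).\<close>
definition is_equivalence :: "('o1, 'm1) grpd \<Rightarrow> ('o2, 'm2) grpd \<Rightarrow> ('o1, 'm1, 'o2, 'm2) gfun \<Rightarrow> bool" where
  "is_equivalence A B F \<longleftrightarrow> is_functor A B F \<and>
     (\<exists>G. is_functor B A G \<and>
        (\<exists>\<eta>. is_nat A A fident (fcomp G F) \<eta>) \<and>
        (\<exists>\<epsilon>. is_nat B B (fcomp F G) fident \<epsilon>))"

definition coprod :: "'i set \<Rightarrow> ('i \<Rightarrow> ('o, 'm) grpd) \<Rightarrow> ('i \<times> 'o, 'i \<times> 'm) grpd" where
  "coprod I A = \<lparr> g_obj = Sigma I (\<lambda>i. g_obj (A i)),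
                  g_arr = Sigma I (\<lambda>i. g_arr (A i)),
                  g_dom = (\<lambda>(i, f). (i, g_dom (A i) f)),
                  g_cod = (\<lambda>(i, f). (i, g_cod (A i) f)),
                  g_id = (\<lambda>(i, x). (i, g_id (A i) x)),
                  g_comp = (\<lambda>(j, g) (i, f). (i, g_comp (A i) g f)) \<rparr>"

type_synonym ('o1, 'm1, 'o2, 'm2) natarr =
  "('o1, 'm1, 'o2, 'm2) gfun \<times> ('o1, 'm1, 'o2, 'm2) gfun \<times> ('o1 \<Rightarrow> 'm2)"

definition hom_grpd :: "('o1, 'm1) grpd \<Rightarrow> ('o2, 'm2) grpd \<Rightarrow>
    (('o1, 'm1, 'o2, 'm2) gfun, ('o1, 'm1, 'o2, 'm2) natarr) grpd" where
  "hom_grpd A D =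
     \<lparr> g_obj = {F. is_functor A D F \<and> F = frestr A F},
       g_arr = {(F, G, \<theta>). is_functor A D F \<and> F = frestr A F \<and>
                            is_functor A D G \<and> G = frestr A G \<and>
                            is_nat A D F G \<theta> \<and> \<theta> \<in> extensional (g_obj A)},
       g_dom = (\<lambda>(F, G, \<theta>). F),
       g_cod = (\<lambda>(F, G, \<theta>). G),
       g_id = (\<lambda>F. (F, F, \<lambda>x\<in>g_obj A. g_id D (fst F x))),
       g_comp = (\<lambda>(G, H, \<psi>) (F, G', \<theta>). (F, H, \<lambda>x\<in>g_obj A. g_comp D (\<psi> x) (\<theta> x))) \<rparr>"

text \<open>A functor from Off(X) (X = the topological space given by the type 'a)
  to groupoids is given by G U for open U and the induced functors
  \<rho> V W : G V -> G W for open V \<subseteq> W.\<close>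

definition is_open_grpd_functor ::
    "('a::topological_space set \<Rightarrow> ('o, 'm) grpd) \<Rightarrow> ('a set \<Rightarrow> 'a set \<Rightarrow> ('o, 'm, 'o, 'm) gfun) \<Rightarrow> bool" where
  "is_open_grpd_functor G \<rho> \<longleftrightarrow>
     (\<forall>U. open U \<longrightarrow> is_groupoid (G U)) \<and>
     (\<forall>V W. open V \<and> open W \<and> V \<subseteq> W \<longrightarrow> is_functor (G V) (G W) (\<rho> V W)) \<and>
     (\<forall>U. open U \<longrightarrow> feq (G U) (\<rho> U U) fident) \<and>
     (\<forall>V W Z. open V \<and> open W \<and> open Z \<and> V \<subseteq> W \<and> W \<subseteq> Z \<longrightarrow>
        feq (G V) (\<rho> V Z) (fcomp (\<rho> W Z) (\<rho> V W)))"

definition is_coequaliser ::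
    "('o1, 'm1) grpd \<Rightarrow> ('o2, 'm2) grpd \<Rightarrow> ('o1, 'm1, 'o2, 'm2) gfun \<Rightarrow> ('o1, 'm1, 'o2, 'm2) gfun \<Rightarrow>
     ('o3, 'm3) grpd \<Rightarrow> ('o2, 'm2, 'o3, 'm3) gfun \<Rightarrow> ('c \<times> 'd) itself \<Rightarrow> bool" where
  "is_coequaliser A B s t C q _ \<longleftrightarrow>
     is_functor A B s \<and> is_functor A B t \<and> is_functor B C q \<and>
     feq A (fcomp q s) (fcomp q t) \<and>
     (\<forall>(D :: ('c, 'd) grpd) F. is_groupoid D \<and> is_functor B D F \<and> feq A (fcomp F s) (fcomp F t) \<longrightarrow>
        (\<exists>H. is_functor C D H \<and> feq B (fcomp H q) F \<and>
           (\<forall>H'. is_functor C D H' \<and> feq B (fcomp H' q) F \<longrightarrow> feq C H' H)))"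

definition cov_left :: "('a set \<Rightarrow> 'a set \<Rightarrow> ('o, 'm, 'o, 'm) gfun) \<Rightarrow> ('i \<Rightarrow> 'a set) \<Rightarrow>
    (('i \<times> 'i) \<times> 'o, ('i \<times> 'i) \<times> 'm, 'i \<times> 'o, 'i \<times> 'm) gfun" where
  "cov_left \<rho> \<U> = ((\<lambda>((i, j), x). (i, fst (\<rho> (\<U> i \<inter> \<U> j) (\<U> i)) x)),
                    (\<lambda>((i, j), f). (i, snd (\<rho> (\<U> i \<inter> \<U> j) (\<U> i)) f)))"

definition cov_right :: "('a set \<Rightarrow> 'a set \<Rightarrow> ('o, 'm, 'o, 'm) gfun) \<Rightarrow> ('i \<Rightarrow> 'a set) \<Rightarrow>
    (('i \<times> 'i) \<times> 'o, ('i \<times> 'i) \<times> 'm, 'i \<times> 'o, 'i \<times> 'm) gfun" where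
  "cov_right \<rho> \<U> = ((\<lambda>((i, j), x). (j, fst (\<rho> (\<U> i \<inter> \<U> j) (\<U> j)) x)),
                     (\<lambda>((i, j), f). (j, snd (\<rho> (\<U> i \<inter> \<U> j) (\<U> j)) f)))"

definition cov_map :: "('a set \<Rightarrow> 'a set \<Rightarrow> ('o, 'm, 'o, 'm) gfun) \<Rightarrow> ('i \<Rightarrow> 'a set) \<Rightarrow> 'a set \<Rightarrow>
    ('i \<times> 'o, 'i \<times> 'm, 'o, 'm) gfun" where
  "cov_map \<rho> \<U> U = ((\<lambda>(i, x). fst (\<rho> (\<U> i) U) x), (\<lambda>(i, f). snd (\<rho> (\<U> i) U) f))"

text \<open>Cosheaf: for every open U and every open covering U = \<Union>_{i\<in>I} \<U> i, the
  functor \<Coprod>_i G(U_i) -> G(U) exhibits G(U) as the coequaliser in small groupoids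
  of the two functors \<Coprod>_{i,j} G(U_i \<inter> U_j) => \<Coprod>_i G(U_i).  Index sets live in
  an arbitrary type 'i and test groupoids in arbitrary types 'c, 'd (the
  theorem is stated for all such types).\<close>

definition is_cosheaf ::
    "('a::topological_space set \<Rightarrow> ('o, 'm) grpd) \<Rightarrow> ('a set \<Rightarrow> 'a set \<Rightarrow> ('o, 'm, 'o, 'm) gfun) \<Rightarrow>
     'i itself \<Rightarrow> ('c \<times> 'd) itself \<Rightarrow> bool" where
  "is_cosheaf G \<rho> _ T \<longleftrightarrow>
     (\<forall>U (I :: 'i set) \<U>. open U \<and> (\<forall>i\<in>I. open (\<U> i)) \<and> U = (\<Union>i\<in>I. \<U> i) \<longrightarrow>
        is_coequaliser
          (coprod (I \<times> I) (\<lambda>(i, j). G (\<U> i \<inter> \<U> j)))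
          (coprod I (\<lambda>i. G (\<U> i)))
          (cov_left \<rho> \<U>) (cov_right \<rho> \<U>)
          (G U) (cov_map \<rho> \<U> U) T)"

definition fres :: "('a set \<Rightarrow> ('o, 'm) grpd) \<Rightarrow> ('a set \<Rightarrow> 'a set \<Rightarrow> ('o, 'm, 'o, 'm) gfun) \<Rightarrow>
    'a set \<Rightarrow> 'a set \<Rightarrow> ('o, 'm, 'o2, 'm2) gfun \<Rightarrow> ('o, 'm, 'o2, 'm2) gfun" where
  "fres G \<rho> V W F = frestr (G V) (fcomp F (\<rho> V W))"

definition ares :: "('a set \<Rightarrow> ('o, 'm) grpd) \<Rightarrow> ('a set \<Rightarrow> 'a set \<Rightarrow> ('o, 'm, 'o, 'm) gfun) \<Rightarrow>
    'a set \<Rightarrow> 'a set \<Rightarrow> ('o, 'm, 'o2, 'm2) natarr \<Rightarrow> ('o, 'm, 'o2, 'm2) natarr" where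
  "ares G \<rho> V W a = (case a of (F, F', \<theta>) \<Rightarrow>
      (fres G \<rho> V W F, fres G \<rho> V W F', \<lambda>x\<in>g_obj (G V). \<theta> (fst (\<rho> V W) x)))"

type_synonym ('i, 'o, 'm, 'o2, 'm2) descobj =
  "('i \<Rightarrow> ('o, 'm, 'o2, 'm2) gfun) \<times> ('i \<times> 'i \<Rightarrow> ('o, 'm, 'o2, 'm2) natarr)"

type_synonym ('i, 'o, 'm, 'o2, 'm2) descarr =
  "('i, 'o, 'm, 'o2, 'm2) descobj \<times> ('i, 'o, 'm, 'o2, 'm2) descobj \<times> ('i \<Rightarrow> ('o, 'm, 'o2, 'm2) natarr)"

definition desc_obj :: "('a set \<Rightarrow> ('o, 'm) grpd) \<Rightarrow> ('a set \<Rightarrow> 'a set \<Rightarrow> ('o, 'm, 'o, 'm) gfun) \<Rightarrow>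
    'i set \<Rightarrow> ('i \<Rightarrow> 'a set) \<Rightarrow> ('o2, 'm2) grpd \<Rightarrow> ('i, 'o, 'm, 'o2, 'm2) descobj set" where
  "desc_obj G \<rho> I \<U> D = {(f, \<phi>).
     f \<in> extensional I \<and> \<phi> \<in> extensional (I \<times> I) \<and>
     (\<forall>i\<in>I. f i \<in> g_obj (hom_grpd (G (\<U> i)) D)) \<and>
     (\<forall>i\<in>I. \<forall>j\<in>I. \<phi> (i, j) \<in> g_arr (hom_grpd (G (\<U> i \<inter> \<U> j)) D) \<and>
        g_dom (hom_grpd (G (\<U> i \<inter> \<U> j)) D) (\<phi> (i, j)) = fres G \<rho> (\<U> i \<inter> \<U> j) (\<U> i) (f i) \<and>
        g_cod (hom_grpd (G (\<U> i \<inter> \<U> j)) D) (\<phi> (i, j)) = fres G \<rho> (\<U> i \<inter> \<U> j) (\<U> j) (f j)) \<and>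
     (\<forall>i\<in>I. \<forall>j\<in>I. \<forall>k\<in>I.
        g_comp (hom_grpd (G (\<U> i \<inter> \<U> j \<inter> \<U> k)) D)
          (ares G \<rho> (\<U> i \<inter> \<U> j \<inter> \<U> k) (\<U> j \<inter> \<U> k) (\<phi> (j, k)))
          (ares G \<rho> (\<U> i \<inter> \<U> j \<inter> \<U> k) (\<U> i \<inter> \<U> j) (\<phi> (i, j)))
        = ares G \<rho> (\<U> i \<inter> \<U> j \<inter> \<U> k) (\<U> i \<inter> \<U> k) (\<phi> (i, k)))}"

definition desc_grpd :: "('a set \<Rightarrow> ('o, 'm) grpd) \<Rightarrow> ('a set \<Rightarrow> 'a set \<Rightarrow> ('o, 'm, 'o, 'm) gfun) \<Rightarrow>
    'i set \<Rightarrow> ('i \<Rightarrow> 'a set) \<Rightarrow> ('o2, 'm2) grpd \<Rightarrow>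
    (('i, 'o, 'm, 'o2, 'm2) descobj, ('i, 'o, 'm, 'o2, 'm2) descarr) grpd" where
  "desc_grpd G \<rho> I \<U> D =
     \<lparr> g_obj = desc_obj G \<rho> I \<U> D,
       g_arr = {((f, \<phi>), (g, \<psi>), \<theta>).
                 (f, \<phi>) \<in> desc_obj G \<rho> I \<U> D \<and> (g, \<psi>) \<in> desc_obj G \<rho> I \<U> D \<and>
                 \<theta> \<in> extensional I \<and>
                 (\<forall>i\<in>I. \<theta> i \<in> g_arr (hom_grpd (G (\<U> i)) D) \<and>
                    g_dom (hom_grpd (G (\<U> i)) D) (\<theta> i) = f i \<and>
                    g_cod (hom_grpd (G (\<U> i)) D) (\<theta> i) = g i) \<and>
                 (\<forall>i\<in>I. \<forall>j\<in>I.
                    g_comp (hom_grpd (G (\<U> i \<inter> \<U> j)) D) (\<psi> (i, j))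
                      (ares G \<rho> (\<U> i \<inter> \<U> j) (\<U> i) (\<theta> i))
                    = g_comp (hom_grpd (G (\<U> i \<inter> \<U> j)) D)
                      (ares G \<rho> (\<U> i \<inter> \<U> j) (\<U> j) (\<theta> j)) (\<phi> (i, j)))},
       g_dom = (\<lambda>(a, b, \<theta>). a),
       g_cod = (\<lambda>(a, b, \<theta>). b),
       g_id = (\<lambda>(f, \<phi>). ((f, \<phi>), (f, \<phi>), \<lambda>i\<in>I. g_id (hom_grpd (G (\<U> i)) D) (f i))),
       g_comp = (\<lambda>(b, c, \<theta>') (a, b', \<theta>).
                   (a, c, \<lambda>i\<in>I. g_comp (hom_grpd (G (\<U> i)) D) (\<theta>' i) (\<theta> i))) \<rparr>"

definition desc_can_obj :: "('a set \<Rightarrow> ('o, 'm) grpd) \<Rightarrow> ('a set \<Rightarrow> 'a set \<Rightarrow> ('o, 'm, 'o, 'm) gfun) \<Rightarrow>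
    'i set \<Rightarrow> ('i \<Rightarrow> 'a set) \<Rightarrow> 'a set \<Rightarrow> ('o2, 'm2) grpd \<Rightarrow>
    ('o, 'm, 'o2, 'm2) gfun \<Rightarrow> ('i, 'o, 'm, 'o2, 'm2) descobj" where
  "desc_can_obj G \<rho> I \<U> U D F =
     ((\<lambda>i\<in>I. fres G \<rho> (\<U> i) U F),
      (\<lambda>p\<in>I \<times> I. case p of (i, j) \<Rightarrow>
          g_id (hom_grpd (G (\<U> i \<inter> \<U> j)) D) (fres G \<rho> (\<U> i \<inter> \<U> j) (\<U> i) (fres G \<rho> (\<U> i) U F))))"

definition desc_can :: "('a set \<Rightarrow> ('o, 'm) grpd) \<Rightarrow> ('a set \<Rightarrow> 'a set \<Rightarrow> ('o, 'm, 'o, 'm) gfun) \<Rightarrow>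
    'i set \<Rightarrow> ('i \<Rightarrow> 'a set) \<Rightarrow> 'a set \<Rightarrow> ('o2, 'm2) grpd \<Rightarrow>
    (('o, 'm, 'o2, 'm2) gfun, ('o, 'm, 'o2, 'm2) natarr,
     ('i, 'o, 'm, 'o2, 'm2) descobj, ('i, 'o, 'm, 'o2, 'm2) descarr) gfun" where
  "desc_can G \<rho> I \<U> U D =
     (desc_can_obj G \<rho> I \<U> U D,
      (\<lambda>(F, F', \<theta>). (desc_can_obj G \<rho> I \<U> U D F, desc_can_obj G \<rho> I \<U> U D F',
                      \<lambda>i\<in>I. ares G \<rho> (\<U> i) U (F, F', \<theta>))))"

definition is_costack ::
    "('a::topological_space set \<Rightarrow> ('o, 'm) grpd) \<Rightarrow> ('a set \<Rightarrow> 'a set \<Rightarrow> ('o, 'm, 'o, 'm) gfun) \<Rightarrow>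
     'i itself \<Rightarrow> ('c \<times> 'd) itself \<Rightarrow> bool" where
  "is_costack G \<rho> _ _ \<longleftrightarrow>
     (\<forall>U (I :: 'i set) \<U> (D :: ('c, 'd) grpd).
        open U \<and> (\<forall>i\<in>I. open (\<U> i)) \<and> U = (\<Union>i\<in>I. \<U> i) \<and> is_groupoid D \<longrightarrow>
        is_equivalence (hom_grpd (G U) D) (desc_grpd G \<rho> I \<U> D) (desc_can G \<rho> I \<U> U D))"

definition path_class :: "'a::topological_space set \<Rightarrow> (real \<Rightarrow> 'a) \<Rightarrow> (real \<Rightarrow> 'a) set" where
  "path_class U p = {q. homotopic_paths U p q}"

definition Pi1 :: "'a::topological_space set \<Rightarrow> ('a, (real \<Rightarrow> 'a) set) grpd" where
  "Pi1 U = \<lparr> g_obj = U,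
             g_arr = {path_class U p | p. path p \<and> path_image p \<subseteq> U},
             g_dom = (\<lambda>c. pathstart (SOME p. p \<in> c)),
             g_cod = (\<lambda>c. pathfinish (SOME p. p \<in> c)),
             g_id = (\<lambda>x. path_class U (\<lambda>t. x)),
             g_comp = (\<lambda>c d. path_class U ((SOME p. p \<in> d) +++ (SOME p. p \<in> c))) \<rparr>"

definition Pi1_incl :: "'a::topological_space set \<Rightarrow> 'a set \<Rightarrow>
    ('a, (real \<Rightarrow> 'a) set, 'a, (real \<Rightarrow> 'a) set) gfun" where
  "Pi1_incl V W = ((\<lambda>x. x), (\<lambda>c. path_class W (SOME p. p \<in> c)))"

end

theory Submission
  imports Defs
begin

text \<open>
  Cosheaf: let compatible functors be given on the fundamental groupoids of the members of an open cover.
  A path contained in a member has a well-defined value, and by compactness of the interval every path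
  is a composite of such paths after sufficiently many dyadic bisections; functoriality makes its value
  independent of the depth. A homotopy is a square which after sufficiently many quadrisections breaks
  into squares contained in members of the cover; each of these commutes, hence so does their pasting.

  Costack: choose for every point x a member c(x) of the cover containing it. Conjugating the functors
  f_i of a descent datum by the transitions between f_i and f_c(x) at each point x makes them agree
  strictly on overlaps, so the cosheaf property glues them. This is a quasi-inverse of the canonical
  functor, with counit given by the transitions, and the unit is the identity. The naturality of
  glued transformations follows from the uniqueness part of the cosheaf property.
\<close>

section \<open>The fundamental groupoid functor\<close>

text \<open>A coequaliser cocone is only compatible on pairs of members; this suffices because a
  path lying in two members is an arrow over their intersection, where its two values are compared.
  Arbitrary subdivisions would have to be compared through common refinements; dyadic ones are
  totally ordered by depth, and since \<open>+++\<close> itself splits at 1/2, the value of a joined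
  path is read off from its halves. Rescaling each half or quarter to the full interval or square
  turns both compactness arguments into inductions on depth in which a Lebesgue number doubles. The
  costack half never looks at paths. It works for every cosheaf of groupoids whose objects over an
  open set are its points, fixed by the extension maps: a member can then be chosen for each object
  separately. A natural transformation is a functor into the arrow groupoid of \<open>D\<close>, but
  that groupoid has other types than the test groupoids at hand; conjugating a functor by the
  candidate components stays within \<open>D\<close>.\<close>

lemma path_const [simp]: "path (\<lambda>t. x)"
  by (simp add: path_def)

text \<open>The straight-line homotopy stays in \<open>C\<close> by convexity, and \<open>h\<close>
  carries it into \<open>S\<close>. Applied with the interval it yields the groupoid laws, with the
  unit square the commutativity of a small square.\<close>

lemma homotopic_paths_reparam_convex:
  fixes a b :: "real \<Rightarrow> 'b::real_normed_vector"
  assumes "convex C" "path a" "path b" "path_image a \<subseteq> C" "path_image b \<subseteq> C"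
    and "pathstart a = pathstart b" "pathfinish a = pathfinish b"
    and "continuous_on C h" "h ` C \<subseteq> S"
  shows "homotopic_paths S (h \<circ> a) (h \<circ> b)"
proof (rule homotopic_paths_continuous_image)
  show "homotopic_paths C a b"
  proof (rule homotopic_paths_linear)
    fix t :: real assume t: "t \<in> {0..1}"
    with assms have "a t \<in> C" "b t \<in> C" by (auto simp: path_image_def)
    then show "closed_segment (a t) (b t) \<subseteq> C"
      using \<open>convex C\<close> by (simp add: closed_segment_subset)
  qed (use assms in auto)
qed (use assms in auto)

text \<open>Both sides of each law are \<open>p\<close> after two paths in the interval with the
  same endpoints. Constant paths are written \<open>\<lambda>t. x\<close> to match
  \<open>g_id\<close> of \<open>Pi1\<close>.\<close>

lemma homotopic_paths_group_laws:
  assumes "path p" "path_image p \<subseteq> S"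
  shows "homotopic_paths S ((\<lambda>t. pathstart p) +++ p) p"
    and "homotopic_paths S (p +++ (\<lambda>t. pathfinish p)) p"
    and "homotopic_paths S (p +++ reversepath p) (\<lambda>t. pathstart p)"
proof -
  have c: "continuous_on {0..1} p" "p ` {0..1} \<subseteq> S"
    using assms by (auto simp: path_def path_image_def)
  let ?i = "\<lambda>t::real. t"
  have i: "path ?i" "path_image ?i = {0..1}" "pathstart ?i = 0" "pathfinish ?i = 1"
    by (auto simp: path_def path_image_def pathstart_def pathfinish_def)
  have k: "path_image (\<lambda>t. x) = {x}" "pathstart (\<lambda>t. x) = x" "pathfinish (\<lambda>t. x) = x" for x :: real
    by (auto simp: path_image_def pathstart_def pathfinish_def)
  have "homotopic_paths S (p \<circ> ((\<lambda>t. 0) +++ ?i)) (p \<circ> ?i)"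
    by (rule homotopic_paths_reparam_convex[where C = "{0..1}"])
       (use c i k in \<open>auto simp: path_image_join\<close>)
  then show "homotopic_paths S ((\<lambda>t. pathstart p) +++ p) p"
    unfolding path_compose_join by (simp add: o_def pathstart_def)
  have "homotopic_paths S (p \<circ> (?i +++ (\<lambda>t. 1))) (p \<circ> ?i)"
    by (rule homotopic_paths_reparam_convex[where C = "{0..1}"])
       (use c i k in \<open>auto simp: path_image_join\<close>)
  then show "homotopic_paths S (p +++ (\<lambda>t. pathfinish p)) p"
    unfolding path_compose_join by (simp add: o_def pathfinish_def)
  have "homotopic_paths S (p \<circ> (?i +++ reversepath ?i)) (p \<circ> (\<lambda>t. 0))"
    by (rule homotopic_paths_reparam_convex[where C = "{0..1}"])
       (use c i k in \<open>auto simp: path_image_join\<close>)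
  then show "homotopic_paths S (p +++ reversepath p) (\<lambda>t. pathstart p)"
    unfolding path_compose_join by (simp add: o_def pathstart_def reversepath_def)
qed

lemma path_class_eqI: "homotopic_paths U p q \<Longrightarrow> path_class U p = path_class U q"
  unfolding path_class_def by (blast intro: homotopic_paths_trans homotopic_paths_sym)

text \<open>The operations of \<open>Pi1\<close> that take a class pick a representative with
  \<open>SOME\<close>. The class of a path in \<open>U\<close> contains that path, so the pick is
  homotopic to it, and whatever is invariant under homotopy in \<open>U\<close> can be computed on
  the original path.\<close>

lemma path_class_rep:
  assumes "path p" "path_image p \<subseteq> U"
  shows "homotopic_paths U p (SOME q. q \<in> path_class U p)"
  using assms someI[of "\<lambda>q. q \<in> path_class U p" p] by (auto simp: path_class_def)

lemma Pi1_obj [simp]: "g_obj (Pi1 U) = U"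
  and Pi1_arr: "g_arr (Pi1 U) = {path_class U p | p. path p \<and> path_image p \<subseteq> U}"
  and Pi1_id: "g_id (Pi1 U) x = path_class U (\<lambda>t. x)"
  by (auto simp: Pi1_def)

lemma Pi1_arrI: "path p \<Longrightarrow> path_image p \<subseteq> U \<Longrightarrow> path_class U p \<in> g_arr (Pi1 U)"
  by (auto simp: Pi1_arr)

lemma Pi1_arrE:
  assumes "c \<in> g_arr (Pi1 U)"
  obtains p where "c = path_class U p" "path p" "path_image p \<subseteq> U"
  using assms by (auto simp: Pi1_arr)

lemma Pi1_dom_class: "path p \<Longrightarrow> path_image p \<subseteq> U \<Longrightarrow> g_dom (Pi1 U) (path_class U p) = pathstart p"
  and Pi1_cod_class: "path p \<Longrightarrow> path_image p \<subseteq> U \<Longrightarrow> g_cod (Pi1 U) (path_class U p) = pathfinish p"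
  using path_class_rep[of p U]
  by (simp_all add: Pi1_def homotopic_paths_imp_pathstart homotopic_paths_imp_pathfinish)

lemma Pi1_comp_class:
  assumes "path p" "path_image p \<subseteq> U" "path q" "path_image q \<subseteq> U" "pathfinish p = pathstart q"
  shows "g_comp (Pi1 U) (path_class U q) (path_class U p) = path_class U (p +++ q)"
proof -
  have "homotopic_paths U (p +++ q) ((SOME r. r \<in> path_class U p) +++ (SOME r. r \<in> path_class U q))"
    using assms by (intro homotopic_paths_join path_class_rep)
  then show ?thesis
    by (simp add: Pi1_def path_class_eqI)
qed

lemma Pi1_incl_class:
  assumes "path p" "path_image p \<subseteq> V" "V \<subseteq> W"
  shows "snd (Pi1_incl V W) (path_class V p) = path_class W p"
  using path_class_eqI[OF homotopic_paths_subset[OF path_class_rep[OF assms(1,2)] assms(3)]]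
  by (simp add: Pi1_incl_def)

lemma fst_Pi1_incl [simp]: "fst (Pi1_incl V W) x = x"
  by (simp add: Pi1_incl_def)

lemma is_groupoid_Pi1: "is_groupoid (Pi1 U)"
proof -
  note cls = Pi1_dom_class Pi1_cod_class Pi1_comp_class Pi1_id
  have sub: "pathstart p \<in> U" "pathfinish p \<in> U" if "path_image p \<subseteq> U" for p :: "real \<Rightarrow> 'a"
    using that pathstart_in_path_image pathfinish_in_path_image by blast+
  have const: "path_image (\<lambda>t. x) \<subseteq> U" "pathstart (\<lambda>t. x) = x" "pathfinish (\<lambda>t. x) = x" if "x \<in> U" for x :: 'a
    using that by (auto simp: path_image_def pathstart_def pathfinish_def)
  show ?thesis
    unfolding is_groupoid_def
  proof (intro conjI ballI impI)
    fix f assume "f \<in> g_arr (Pi1 U)"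
    then obtain p where f: "f = path_class U p" and p: "path p" "path_image p \<subseteq> U"
      by (rule Pi1_arrE)
    show "g_dom (Pi1 U) f \<in> g_obj (Pi1 U)" "g_cod (Pi1 U) f \<in> g_obj (Pi1 U)"
      using p by (simp_all add: f cls sub)
    show "g_comp (Pi1 U) (g_id (Pi1 U) (g_cod (Pi1 U) f)) f = f"
      using p by (simp add: f cls sub const path_class_eqI[OF homotopic_paths_group_laws(2)])
    show "g_comp (Pi1 U) f (g_id (Pi1 U) (g_dom (Pi1 U) f)) = f"
      using p by (simp add: f cls sub const path_class_eqI[OF homotopic_paths_group_laws(1)])
    \<comment> \<open>The other inverse law is the third group law for the reversed path.\<close>
    have r: "homotopic_paths U (reversepath p +++ p) (\<lambda>t. pathfinish p)"
      using homotopic_paths_group_laws(3)[of "reversepath p" U] p by simp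
    show "\<exists>g\<in>g_arr (Pi1 U). g_dom (Pi1 U) g = g_cod (Pi1 U) f \<and> g_cod (Pi1 U) g = g_dom (Pi1 U) f \<and>
        g_comp (Pi1 U) g f = g_id (Pi1 U) (g_dom (Pi1 U) f) \<and>
        g_comp (Pi1 U) f g = g_id (Pi1 U) (g_cod (Pi1 U) f)"
      by (rule bexI[of _ "path_class U (reversepath p)"])
         (use p in \<open>auto simp: f cls path_class_eqI[OF homotopic_paths_group_laws(3)] path_class_eqI[OF r] intro!: Pi1_arrI\<close>)
  next
    fix x assume "x \<in> g_obj (Pi1 U)"
    then have x: "x \<in> U" by simp
    show "g_id (Pi1 U) x \<in> g_arr (Pi1 U)" "g_dom (Pi1 U) (g_id (Pi1 U) x) = x"
      "g_cod (Pi1 U) (g_id (Pi1 U) x) = x"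
      using const[OF x] by (simp_all add: cls Pi1_arrI)
  next
    fix f g assume "f \<in> g_arr (Pi1 U)" "g \<in> g_arr (Pi1 U)" and fg: "g_cod (Pi1 U) f = g_dom (Pi1 U) g"
    then obtain p q where f: "f = path_class U p" and p: "path p" "path_image p \<subseteq> U"
      and g: "g = path_class U q" and q: "path q" "path_image q \<subseteq> U"
      by (metis Pi1_arrE)
    have j: "path (p +++ q)" "path_image (p +++ q) \<subseteq> U" "pathfinish p = pathstart q"
      using fg p q by (simp_all add: f g cls path_image_join)
    show "g_comp (Pi1 U) g f \<in> g_arr (Pi1 U)"
      "g_dom (Pi1 U) (g_comp (Pi1 U) g f) = g_dom (Pi1 U) f"
      "g_cod (Pi1 U) (g_comp (Pi1 U) g f) = g_cod (Pi1 U) g"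
      using p q j by (simp_all add: f g cls Pi1_arrI)
    fix h assume "h \<in> g_arr (Pi1 U)" and gh: "g_cod (Pi1 U) g = g_dom (Pi1 U) h"
    then obtain r where h: "h = path_class U r" and r: "path r" "path_image r \<subseteq> U"
      by (metis Pi1_arrE)
    have e: "pathfinish q = pathstart r"
      using gh q r by (simp add: g h cls)
    have "homotopic_paths U (p +++ (q +++ r)) ((p +++ q) +++ r)"
      using p q r e j by (intro homotopic_paths_assoc) auto
    then show "g_comp (Pi1 U) h (g_comp (Pi1 U) g f) = g_comp (Pi1 U) (g_comp (Pi1 U) h g) f"
      using p q r e j by (simp add: f g h cls path_image_join path_class_eqI)
  qed
qed

lemma is_functor_Pi1_incl:
  assumes "V \<subseteq> W"
  shows "is_functor (Pi1 V) (Pi1 W) (Pi1_incl V W)"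
proof -
  have W: "path_image p \<subseteq> W" if "path_image p \<subseteq> V" for p :: "real \<Rightarrow> 'a"
    using that assms by blast
  note cls = Pi1_dom_class Pi1_cod_class Pi1_comp_class Pi1_id Pi1_incl_class[OF _ _ assms] W
  show ?thesis
    unfolding is_functor_def
  proof (intro conjI ballI impI)
    fix f assume "f \<in> g_arr (Pi1 V)"
    then obtain p where f: "f = path_class V p" and p: "path p" "path_image p \<subseteq> V"
      by (rule Pi1_arrE)
    show "snd (Pi1_incl V W) f \<in> g_arr (Pi1 W)"
      "g_dom (Pi1 W) (snd (Pi1_incl V W) f) = fst (Pi1_incl V W) (g_dom (Pi1 V) f)"
      "g_cod (Pi1 W) (snd (Pi1_incl V W) f) = fst (Pi1_incl V W) (g_cod (Pi1 V) f)"
      using p by (simp_all add: f cls Pi1_arrI)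
    fix g assume "g \<in> g_arr (Pi1 V)" and fg: "g_cod (Pi1 V) f = g_dom (Pi1 V) g"
    then obtain q where g: "g = path_class V q" and q: "path q" "path_image q \<subseteq> V"
      by (metis Pi1_arrE)
    have "path (p +++ q)" "path_image (p +++ q) \<subseteq> V" "pathfinish p = pathstart q"
      using fg p q by (simp_all add: f g cls path_image_join)
    then show "snd (Pi1_incl V W) (g_comp (Pi1 V) g f)
      = g_comp (Pi1 W) (snd (Pi1_incl V W) g) (snd (Pi1_incl V W) f)"
      using p q by (simp add: f g cls)
  next
    fix x assume "x \<in> g_obj (Pi1 V)"
    then show "fst (Pi1_incl V W) x \<in> g_obj (Pi1 W)"
      "snd (Pi1_incl V W) (g_id (Pi1 V) x) = g_id (Pi1 W) (fst (Pi1_incl V W) x)"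
      using assms by (auto simp: cls path_image_def)
  qed
qed

lemma is_open_grpd_functor_Pi1: "is_open_grpd_functor Pi1 Pi1_incl"
  unfolding is_open_grpd_functor_def feq_def fcomp_def fident_def
  by (fastforce simp: is_groupoid_Pi1 is_functor_Pi1_incl Pi1_incl_class elim!: Pi1_arrE)

section \<open>Groupoids\<close>

text \<open>Endpoints are carried along with membership, so that composability is checked by
  matching them instead of rewriting with \<open>g_dom\<close> and \<open>g_cod\<close>.\<close>

definition in_hom :: "('o, 'm) grpd \<Rightarrow> 'm \<Rightarrow> 'o \<Rightarrow> 'o \<Rightarrow> bool" where
  "in_hom D f x y \<longleftrightarrow> f \<in> g_arr D \<and> g_dom D f = x \<and> g_cod D f = y"

locale groupoid =
  fixes D :: "('o, 'm) grpd"
  assumes is_groupoid: "is_groupoid D"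
begin

lemma in_hom_obj: "in_hom D f x y \<Longrightarrow> x \<in> g_obj D \<and> y \<in> g_obj D"
  using is_groupoid unfolding is_groupoid_def in_hom_def by blast

lemma in_hom_id: "x \<in> g_obj D \<Longrightarrow> in_hom D (g_id D x) x x"
  using is_groupoid unfolding is_groupoid_def in_hom_def by blast

lemma in_hom_comp: "in_hom D f x y \<Longrightarrow> in_hom D g y z \<Longrightarrow> in_hom D (g_comp D g f) x z"
  using is_groupoid unfolding is_groupoid_def in_hom_def by metis

lemma comp_id_left: "in_hom D f x y \<Longrightarrow> g_comp D (g_id D y) f = f"
  and comp_id_right: "in_hom D f x y \<Longrightarrow> g_comp D f (g_id D x) = f"
  using is_groupoid unfolding is_groupoid_def in_hom_def by blast+

lemma comp_assoc:
  "in_hom D f x y \<Longrightarrow> in_hom D g y z \<Longrightarrow> in_hom D h z w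
    \<Longrightarrow> g_comp D (g_comp D h g) f = g_comp D h (g_comp D g f)"
  using is_groupoid unfolding is_groupoid_def in_hom_def by metis

lemma obtain_inverse:
  assumes "in_hom D f x y"
  obtains g where "in_hom D g y x" "g_comp D g f = g_id D x" "g_comp D f g = g_id D y"
  using is_groupoid assms unfolding is_groupoid_def in_hom_def by metis

text \<open>The main tool for equations in \<open>D\<close>: two arrows are compared after composing
  with an invertible arrow, such as a transition, behind which naturality applies.\<close>

lemma comp_cancel_left:
  assumes "in_hom D f x y" "in_hom D g x y" "in_hom D h y z" "g_comp D h f = g_comp D h g"
  shows "f = g"
proof -
  obtain k where k: "in_hom D k z y" "g_comp D k h = g_id D y"
    by (rule obtain_inverse[OF assms(3)])
  have "f = g_comp D (g_comp D k h) f"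
    using assms(1) k by (simp add: comp_id_left)
  also have "\<dots> = g_comp D (g_comp D k h) g"
    using comp_assoc[OF assms(1,3) k(1)] comp_assoc[OF assms(2,3) k(1)] assms(4) by simp
  also have "\<dots> = g"
    using assms(2) k by (simp add: comp_id_left)
  finally show ?thesis .
qed

text \<open>In a 2 by 2 grid the first index of a corner runs to the right and the second upwards.
  The rows are \<open>b\<close>, \<open>m\<close>, \<open>t\<close> from bottom to top, the columns
  \<open>l\<close>, \<open>c\<close>, \<open>r\<close> from left to right; the chain moves the route
  along the bottom and the right side across one small square at a time.\<close>

lemma paste_squares:
  assumes hom: "in_hom D b0 x00 x10" "in_hom D b1 x10 x20" "in_hom D m0 x01 x11" "in_hom D m1 x11 x21"
      "in_hom D t0 x02 x12" "in_hom D t1 x12 x22" "in_hom D l0 x00 x01" "in_hom D l1 x01 x02"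
      "in_hom D c0 x10 x11" "in_hom D c1 x11 x12" "in_hom D r0 x20 x21" "in_hom D r1 x21 x22"
    and sq: "g_comp D c0 b0 = g_comp D m0 l0" "g_comp D r0 b1 = g_comp D m1 c0"
      "g_comp D c1 m0 = g_comp D t0 l1" "g_comp D r1 m1 = g_comp D t1 c1"
  shows "g_comp D (g_comp D r1 r0) (g_comp D b1 b0) = g_comp D (g_comp D t1 t0) (g_comp D l1 l0)"
proof -
  have "g_comp D (g_comp D r1 r0) (g_comp D b1 b0) = g_comp D r1 (g_comp D (g_comp D r0 b1) b0)"
    using comp_assoc[OF in_hom_comp[OF hom(1,2)] hom(11,12)] comp_assoc[OF hom(1,2,11)] by simp
  also have "\<dots> = g_comp D r1 (g_comp D m1 (g_comp D c0 b0))"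
    using comp_assoc[OF hom(1,9,4)] by (simp add: sq(2))
  also have "\<dots> = g_comp D (g_comp D r1 m1) (g_comp D m0 l0)"
    using comp_assoc[OF in_hom_comp[OF hom(7,3)] hom(4,12)] by (simp add: sq(1))
  also have "\<dots> = g_comp D t1 (g_comp D (g_comp D c1 m0) l0)"
    using comp_assoc[OF in_hom_comp[OF hom(7,3)] hom(10,6)] comp_assoc[OF hom(7,3,10)]
    by (simp add: sq(4))
  also have "\<dots> = g_comp D (g_comp D t1 t0) (g_comp D l1 l0)"
    using comp_assoc[OF in_hom_comp[OF hom(7,8)] hom(5,6)] comp_assoc[OF hom(7,8,5)]
    by (simp add: sq(3))
  finally show ?thesis .
qed

end

lemma functor_in_hom:
  assumes "is_functor A B F" "in_hom A f x y"
  shows "in_hom B (snd F f) (fst F x) (fst F y)"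
  using assms unfolding is_functor_def in_hom_def by blast

lemma functor_comp:
  assumes "is_functor A B F" "in_hom A f x y" "in_hom A g y z"
  shows "snd F (g_comp A g f) = g_comp B (snd F g) (snd F f)"
  using assms unfolding is_functor_def in_hom_def by auto

section \<open>Gluing functors on fundamental groupoids\<close>

definition half :: "real \<Rightarrow> (real \<Rightarrow> 'a) \<Rightarrow> real \<Rightarrow> 'a" where
  "half a p = (\<lambda>t. p ((a + t) / 2))"

lemma half_cong:
  assumes "\<And>t. t \<in> {0..1} \<Longrightarrow> p t = q t" "a \<in> {0..1}" "t \<in> {0..1}"
  shows "half a p t = half a q t"
proof -
  have "(a + t) / 2 \<in> {0..1}"
    using assms(2,3) by simp
  then show ?thesis
    unfolding half_def by (rule assms(1))
qed

text \<open>An equality of functions on the whole line, not just a homotopy, because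
  \<open>+++\<close> also splits at 1/2 and rescales linearly.\<close>

lemma half_join: "half 0 p +++ half 1 p = p"
  by (auto simp: half_def joinpaths_def fun_eq_iff)

lemma path_half:
  assumes "path p" "a \<in> {0..1}"
  shows "path (half a p)"
  unfolding path_def half_def
  by (rule continuous_on_compose2[OF assms(1)[unfolded path_def]])
     (use assms in \<open>auto intro!: continuous_intros\<close>)

lemma path_image_half: "a \<in> {0..1} \<Longrightarrow> path_image (half a p) \<subseteq> path_image p"
  by (auto simp: path_image_def half_def)

lemma half_ends:
  "pathstart (half 0 p) = pathstart p" "pathfinish (half 0 p) = pathstart (half 1 p)"
  "pathfinish (half 1 p) = pathfinish p"
  by (simp_all add: half_def pathstart_def pathfinish_def)

section \<open>Lebesgue numbers of pulled-back covers\<close>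

definition meshed :: "('i \<Rightarrow> 'a set) \<Rightarrow> 'i set \<Rightarrow> 'b::metric_space set \<Rightarrow> real \<Rightarrow> ('b \<Rightarrow> 'a) \<Rightarrow> bool" where
  "meshed \<U> I S e g \<longleftrightarrow> (\<forall>x\<in>S. \<exists>i\<in>I. g ` (S \<inter> ball x e) \<subseteq> \<U> i)"

text \<open>\<open>e\<close> is a Lebesgue number of the cover of \<open>S\<close> by preimages
  under \<open>g\<close>. These are only relatively open in \<open>S\<close>, so each is first
  extended to an open set \<open>A i\<close> of the ambient space.\<close>

lemma meshed_exists:
  fixes g :: "'b::metric_space \<Rightarrow> 'a::topological_space"
  assumes "compact S" "continuous_on S g" "g ` S \<subseteq> (\<Union>i\<in>I. \<U> i)" "\<And>i. i \<in> I \<Longrightarrow> open (\<U> i)"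
  obtains e where "e > 0" "meshed \<U> I S e g"
proof -
  have "\<forall>i\<in>I. \<exists>A. open A \<and> A \<inter> S = g -` \<U> i \<inter> S"
    using assms(2,4) unfolding continuous_on_open_invariant by blast
  then obtain A where A: "\<And>i. i \<in> I \<Longrightarrow> open (A i)" "\<And>i. i \<in> I \<Longrightarrow> A i \<inter> S = g -` \<U> i \<inter> S"
    by metis
  have "S \<subseteq> \<Union> (A ` I)"
  proof
    fix x assume "x \<in> S"
    then obtain i where "i \<in> I" "x \<in> g -` \<U> i \<inter> S"
      using assms(3) by auto
    then show "x \<in> \<Union> (A ` I)"
      using A(2)[of i] by auto
  qed
  then obtain e where "e > 0" and e: "\<And>x. x \<in> S \<Longrightarrow> \<exists>G\<in>A ` I. ball x e \<subseteq> G"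
    by (rule Heine_Borel_lemma[OF assms(1)]) (auto simp: A(1))
  have "meshed \<U> I S e g"
    unfolding meshed_def
  proof
    fix x assume "x \<in> S"
    then obtain i where "i \<in> I" "ball x e \<subseteq> A i"
      using e by blast
    then show "\<exists>i\<in>I. g ` (S \<inter> ball x e) \<subseteq> \<U> i"
      using A(2)[OF \<open>i \<in> I\<close>] by auto
  qed
  with \<open>e > 0\<close> show thesis
    by (rule that)
qed

text \<open>Restricting to a half-size piece and rescaling it to all of \<open>S\<close> doubles the
  Lebesgue number: \<open>\<phi>\<close> sends a ball of radius \<open>2 * e\<close> into one of
  radius \<open>e\<close>.\<close>

lemma meshed_contract:
  assumes "meshed \<U> I S e g" "\<phi> ` S \<subseteq> S"
    and "\<And>x y. x \<in> S \<Longrightarrow> y \<in> S \<Longrightarrow> dist (\<phi> x) (\<phi> y) \<le> dist x y / 2"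
  shows "meshed \<U> I S (2 * e) (g \<circ> \<phi>)"
  unfolding meshed_def
proof
  fix x assume x: "x \<in> S"
  then obtain i where "i \<in> I" and i: "g ` (S \<inter> ball (\<phi> x) e) \<subseteq> \<U> i"
    using assms(1,2) unfolding meshed_def by blast
  have "\<phi> y \<in> S \<inter> ball (\<phi> x) e" if "y \<in> S \<inter> ball x (2 * e)" for y
    using that assms(2) assms(3)[OF x, of y] by auto
  then show "\<exists>i\<in>I. (g \<circ> \<phi>) ` (S \<inter> ball x (2 * e)) \<subseteq> \<U> i"
    using \<open>i \<in> I\<close> i by fastforce
qed

lemma meshed_whole:
  assumes "meshed \<U> I S e g" "x \<in> S" "S \<subseteq> ball x e"
  shows "\<exists>i\<in>I. g ` S \<subseteq> \<U> i"
proof -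
  have "S \<inter> ball x e = S"
    using assms(3) by blast
  then show ?thesis
    using assms(1,2) unfolding meshed_def by metis
qed

text \<open>Homotopy of paths ignores values off the unit interval, whereas the halves of a joined
  path coincide with the two pieces only on it.\<close>

lemma path_class_cong:
  assumes "\<And>t. t \<in> {0..1} \<Longrightarrow> p t = q t"
  shows "path_class U p = path_class U q"
  using assms by (simp add: path_class_def homotopic_paths pathstart_def pathfinish_def)

lemma path_image_cong:
  "(\<And>t. t \<in> {0..1} \<Longrightarrow> p t = q t) \<Longrightarrow> path_image p = path_image q"
  by (auto simp: path_image_def)

lemma in_hom_Pi1:
  "path p \<Longrightarrow> path_image p \<subseteq> U \<Longrightarrow> in_hom (Pi1 U) (path_class U p) (pathstart p) (pathfinish p)"
  by (simp add: in_hom_def Pi1_arrI Pi1_dom_class Pi1_cod_class)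

lemma functor_Pi1_join:
  assumes "is_functor (Pi1 U) D F" "path p" "path_image p \<subseteq> U" "path q" "path_image q \<subseteq> U"
    "pathfinish p = pathstart q"
  shows "snd F (path_class U (p +++ q)) = g_comp D (snd F (path_class U q)) (snd F (path_class U p))"
proof -
  have "in_hom (Pi1 U) (path_class U p) (pathstart p) (pathstart q)"
    using in_hom_Pi1[OF assms(2,3)] assms(6) by simp
  from functor_comp[OF assms(1) this in_hom_Pi1[OF assms(4,5)]] show ?thesis
    using assms by (simp add: Pi1_comp_class)
qed

section \<open>Values of paths by repeated bisection\<close>

locale pi1_gluing = groupoid D
  for D :: "('c, 'd) grpd" +
  fixes I :: "'i set" and \<U> :: "'i \<Rightarrow> 'a::topological_space set"
    and f :: "'i \<Rightarrow> ('a, (real \<Rightarrow> 'a) set, 'c, 'd) gfun"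
  assumes open_cover: "\<And>i. i \<in> I \<Longrightarrow> open (\<U> i)"
    and is_functor: "\<And>i. i \<in> I \<Longrightarrow> is_functor (Pi1 (\<U> i)) D (f i)"
    and obj_agree: "\<And>i j x. i \<in> I \<Longrightarrow> j \<in> I \<Longrightarrow> x \<in> \<U> i \<Longrightarrow> x \<in> \<U> j \<Longrightarrow> fst (f i) x = fst (f j) x"
    and path_agree: "\<And>i j p. i \<in> I \<Longrightarrow> j \<in> I \<Longrightarrow> path p \<Longrightarrow> path_image p \<subseteq> \<U> i \<Longrightarrow> path_image p \<subseteq> \<U> j
      \<Longrightarrow> snd (f i) (path_class (\<U> i) p) = snd (f j) (path_class (\<U> j) p)"
begin

definition total :: "'a set" where
  "total = (\<Union>i\<in>I. \<U> i)"

definition glue_obj :: "'a \<Rightarrow> 'c" where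
  "glue_obj x = fst (f (SOME i. i \<in> I \<and> x \<in> \<U> i)) x"

definition local_value :: "(real \<Rightarrow> 'a) \<Rightarrow> 'd" where
  "local_value p = (let i = SOME i. i \<in> I \<and> path_image p \<subseteq> \<U> i in snd (f i) (path_class (\<U> i) p))"

text \<open>All pieces are bisected equally often. Uneven subdivisions are excluded, which makes any
  two admissible depths comparable.\<close>

primrec small :: "nat \<Rightarrow> (real \<Rightarrow> 'a) \<Rightarrow> bool" where
  "small 0 p \<longleftrightarrow> (\<exists>i\<in>I. path_image p \<subseteq> \<U> i)"
| "small (Suc n) p \<longleftrightarrow> small n (half 0 p) \<and> small n (half 1 p)"

primrec dyadic_value :: "nat \<Rightarrow> (real \<Rightarrow> 'a) \<Rightarrow> 'd" where
  "dyadic_value 0 p = local_value p"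
| "dyadic_value (Suc n) p = g_comp D (dyadic_value n (half 1 p)) (dyadic_value n (half 0 p))"

text \<open>By compactness every path in \<open>total\<close> has an admissible depth; for other
  paths the \<open>LEAST\<close> is a junk value.\<close>

definition path_value :: "(real \<Rightarrow> 'a) \<Rightarrow> 'd" where
  "path_value p = dyadic_value (LEAST n. small n p) p"

lemma glue_obj_eq: "i \<in> I \<Longrightarrow> x \<in> \<U> i \<Longrightarrow> glue_obj x = fst (f i) x"
  unfolding glue_obj_def by (rule someI2[of _ i]) (auto intro: obj_agree)

lemma local_value_eq:
  assumes "i \<in> I" "path p" "path_image p \<subseteq> \<U> i"
  shows "local_value p = snd (f i) (path_class (\<U> i) p)"
  unfolding local_value_def Let_def
  by (rule someI2[of _ i]) (use assms in \<open>auto intro: path_agree\<close>)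

lemma dyadic_value_in_hom:
  "path p \<Longrightarrow> small n p \<Longrightarrow> in_hom D (dyadic_value n p) (glue_obj (pathstart p)) (glue_obj (pathfinish p))"
proof (induction n arbitrary: p)
  case 0
  then obtain i where i: "i \<in> I" "path_image p \<subseteq> \<U> i"
    by auto
  then have "pathstart p \<in> \<U> i" "pathfinish p \<in> \<U> i"
    using pathstart_in_path_image pathfinish_in_path_image by blast+
  with i 0 show ?case
    using functor_in_hom[OF is_functor[OF i(1)] in_hom_Pi1[OF \<open>path p\<close> i(2)]]
    by (simp add: local_value_eq glue_obj_eq)
next
  case (Suc n)
  then have "in_hom D (dyadic_value n (half 0 p)) (glue_obj (pathstart p)) (glue_obj (pathstart (half 1 p)))"
    "in_hom D (dyadic_value n (half 1 p)) (glue_obj (pathstart (half 1 p))) (glue_obj (pathfinish p))"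
    using Suc.IH[of "half 0 p"] Suc.IH[of "half 1 p"] by (simp_all add: path_half half_ends)
  then show ?case
    by (simp add: in_hom_comp)
qed

lemma small_Suc: "small n p \<Longrightarrow> small (Suc n) p"
proof (induction n arbitrary: p)
  case 0
  then obtain i where i: "i \<in> I" "path_image p \<subseteq> \<U> i"
    by auto
  have "path_image (half a p) \<subseteq> \<U> i" if "a \<in> {0..1}" for a
    using path_image_half[OF that] i(2) by (rule order.trans)
  from this[of 0] this[of 1] i(1) show ?case
    by auto
next
  case (Suc n)
  then have "small (Suc n) (half 0 p)" "small (Suc n) (half 1 p)"
    by (simp_all del: small.simps add: small.simps(2)[of n p])
  then show ?case
    by (simp only: small.simps(2)[of "Suc n"])
qed

text \<open>The content sits at depth 0, where the path lies in one member and functoriality of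
  \<open>f i\<close> on its two halves gives the claim; the step applies the claim to both
  halves.\<close>

lemma dyadic_value_Suc: "path p \<Longrightarrow> small n p \<Longrightarrow> dyadic_value (Suc n) p = dyadic_value n p"
proof (induction n arbitrary: p)
  case 0
  then obtain i where i: "i \<in> I" "path_image p \<subseteq> \<U> i"
    by auto
  have h: "path (half a p)" "path_image (half a p) \<subseteq> \<U> i" if "a \<in> {0..1}" for a
    using path_half[OF 0(1) that] path_image_half[OF that, of p] i(2) by auto
  have "snd (f i) (path_class (\<U> i) (half 0 p +++ half 1 p))
      = g_comp D (snd (f i) (path_class (\<U> i) (half 1 p))) (snd (f i) (path_class (\<U> i) (half 0 p)))"
    by (rule functor_Pi1_join) (use is_functor i h in \<open>auto simp: half_ends\<close>)
  then show ?case
    using i h 0 by (simp add: local_value_eq[OF i(1)] half_join)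
next
  case (Suc n)
  then show ?case
    by (simp add: path_half del: dyadic_value.simps(2) add: dyadic_value.simps(2)[of "Suc n"])
       (simp add: path_half)
qed

lemma dyadic_value_mono:
  assumes "path p" "small n p" "n \<le> m"
  shows "small m p \<and> dyadic_value m p = dyadic_value n p"
  using assms(3)
proof (induction m rule: dec_induct)
  case base
  then show ?case using assms by simp
next
  case (step k)
  then show ?case using assms(1) small_Suc dyadic_value_Suc by metis
qed

lemma path_value_eq:
  assumes "path p" "small n p"
  shows "path_value p = dyadic_value n p"
  unfolding path_value_def
  using dyadic_value_mono[OF assms(1) LeastI[of "\<lambda>n. small n p", OF assms(2)] Least_le[of "\<lambda>n. small n p", OF assms(2)]]
  by simp

text \<open>Each bisection doubles the Lebesgue number. Once it exceeds 1, the ball around 0 covers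
  the unit interval and the piece lies in one member; hence the bound
  \<open>1 < 2 ^ n * e\<close>.\<close>

lemma meshed_small:
  "path p \<Longrightarrow> meshed \<U> I {0..1} e p \<Longrightarrow> 1 < 2 ^ n * e \<Longrightarrow> small n p"
proof (induction n arbitrary: p e)
  case 0
  then have "{0..1::real} \<subseteq> ball 0 e"
    by (auto simp: dist_real_def)
  then have "\<exists>i\<in>I. p ` {0..1} \<subseteq> \<U> i"
    using meshed_whole[OF 0(2), of 0] by auto
  then show ?case
    by (simp add: path_image_def)
next
  case (Suc n)
  have "meshed \<U> I {0..1} (2 * e) (half a p)" if "a \<in> {0..1}" for a
  proof -
    have "dist ((a + x) / 2) ((a + y) / 2) \<le> dist x y / 2" for x y :: real
      unfolding dist_real_def diff_divide_distrib[symmetric] by simp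
    then have "meshed \<U> I {0..1} (2 * e) (p \<circ> (\<lambda>t. (a + t) / 2))"
      by (intro meshed_contract[OF Suc.prems(2)]) (use that in auto)
    then show ?thesis
      by (simp add: half_def o_def)
  qed
  then show ?case
    using Suc.IH[of _ "2 * e"] Suc.prems by (simp add: path_half mult.assoc)
qed

lemma small_exists:
  assumes "path p" "path_image p \<subseteq> total"
  obtains n where "small n p"
proof -
  obtain e where "e > 0" "meshed \<U> I {0..1} e p"
    using meshed_exists[of "{0..1}" p \<U> I] assms open_cover
    by (auto simp: path_def path_image_def total_def)
  moreover obtain n where "1 / e < 2 ^ n"
    using real_arch_pow[of 2 "1 / e"] by auto
  ultimately have "small n p"
    by (intro meshed_small[of p e]) (use assms in \<open>auto simp: field_simps\<close>)
  then show thesis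
    by (rule that)
qed

lemma path_value_in_hom:
  assumes "path p" "path_image p \<subseteq> total"
  shows "in_hom D (path_value p) (glue_obj (pathstart p)) (glue_obj (pathfinish p))"
  using assms by (metis small_exists path_value_eq dyadic_value_in_hom)

lemma path_value_local:
  assumes "i \<in> I" "path p" "path_image p \<subseteq> \<U> i"
  shows "path_value p = snd (f i) (path_class (\<U> i) p)"
  using assms path_value_eq[of p 0] by (auto simp: local_value_eq)

lemma path_value_half:
  assumes "path p" "path_image p \<subseteq> total"
  shows "path_value p = g_comp D (path_value (half 1 p)) (path_value (half 0 p))"
proof -
  obtain n where "small n p"
    using assms small_exists by blast
  \<comment> \<open>One extra level, so that the value unfolds into the values of the two halves at
    depth \<open>n\<close>.\<close>
  then have n: "small (Suc n) p"
    by (rule small_Suc)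
  then show ?thesis
    using assms path_value_eq[OF assms(1) n] path_value_eq[of "half 0 p" n] path_value_eq[of "half 1 p" n]
    by (simp add: path_half)
qed

text \<open>\<open>path_value\<close> searches for its depth, so smallness and value are shown
  invariant together.\<close>

lemma path_value_cong:
  assumes "\<And>t. t \<in> {0..1} \<Longrightarrow> p t = q t"
  shows "path_value p = path_value q"
proof -
  have "small n p = small n q \<and> dyadic_value n p = dyadic_value n q"
    if "\<And>t. t \<in> {0..1} \<Longrightarrow> p t = q t" for n and p q :: "real \<Rightarrow> 'a"
    using that
  proof (induction n arbitrary: p q)
    case 0
    have "path_image p = path_image q" "path_class U p = path_class U q" for U
      by (rule path_image_cong[OF 0], assumption) (rule path_class_cong[OF 0], assumption)
    then show ?case
      by (simp add: local_value_def)
  next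
    case (Suc n)
    have "small n (half a p) = small n (half a q) \<and> dyadic_value n (half a p) = dyadic_value n (half a q)"
      if "a \<in> {0..1}" for a
      by (rule Suc.IH) (rule half_cong[OF Suc.prems that])
    from this[of 0] this[of 1] show ?case
      by simp
  qed
  note same = this[OF assms]
  have "(\<lambda>n. small n p) = (\<lambda>n. small n q)" "\<And>n. dyadic_value n p = dyadic_value n q"
    using same by auto
  then show ?thesis
    unfolding path_value_def by simp
qed

lemma path_value_join:
  assumes "path p" "path_image p \<subseteq> total" "path q" "path_image q \<subseteq> total" "pathfinish p = pathstart q"
  shows "path_value (p +++ q) = g_comp D (path_value q) (path_value p)"
proof -
  have "path_value (half 0 (p +++ q)) = path_value p"
    by (rule path_value_cong) (auto simp: half_def joinpaths_def)
  moreover have "path_value (half 1 (p +++ q)) = path_value q"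
  proof (rule path_value_cong)
    fix t :: real assume "t \<in> {0..1}"
    \<comment> \<open>At \<open>t = 0\<close> the point 1/2 falls into the first branch of
      \<open>joinpaths\<close>, and the matching endpoints give the value there.\<close>
    then show "half 1 (p +++ q) t = q t"
      using assms(5) by (cases "t = 0") (auto simp: half_def joinpaths_def pathstart_def pathfinish_def add_divide_distrib)
  qed
  ultimately show ?thesis
    using path_value_half[of "p +++ q"] assms by (simp add: path_image_join)
qed

lemma path_value_const:
  assumes "x \<in> total"
  shows "path_value (\<lambda>t. x) = g_id D (glue_obj x)"
proof -
  obtain i where i: "i \<in> I" "x \<in> \<U> i"
    using assms by (auto simp: total_def)
  then have "path_value (\<lambda>t. x) = snd (f i) (g_id (Pi1 (\<U> i)) x)"
    using path_value_local[of i "\<lambda>t. x"] by (auto simp: Pi1_id path_image_def)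
  then show ?thesis
    using is_functor[OF i(1)] i by (simp add: is_functor_def glue_obj_eq)
qed

section \<open>Subdivided squares and homotopy invariance\<close>

abbreviation square :: "(real \<times> real) set" where
  "square \<equiv> {0..1} \<times> {0..1}"

text \<open>The quarter with lower left corner (a/2, b/2), rescaled to the full square.\<close>

definition quarter :: "real \<Rightarrow> real \<Rightarrow> (real \<times> real \<Rightarrow> 'a) \<Rightarrow> real \<times> real \<Rightarrow> 'a" where
  "quarter a b h = h \<circ> (\<lambda>z. ((a + fst z) / 2, (b + snd z) / 2))"

lemma path_edge:
  fixes h :: "real \<times> real \<Rightarrow> 'a"
  assumes "continuous_on square h" "h ` square \<subseteq> S" "a \<in> {0..1}"
  shows "path (\<lambda>t. h (a, t))" "path_image (\<lambda>t. h (a, t)) \<subseteq> S"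
    "path (\<lambda>t. h (t, a))" "path_image (\<lambda>t. h (t, a)) \<subseteq> S"
proof -
  show "path (\<lambda>t. h (a, t))" "path (\<lambda>t. h (t, a))"
    unfolding path_def
    by (rule continuous_on_compose2[OF assms(1)]; use assms(3) in \<open>auto intro!: continuous_intros\<close>)+
qed (use assms in \<open>auto simp: path_image_def\<close>)

text \<open>Quartering the square doubles the Lebesgue number. The bound 2 exceeds the diagonal sqrt
  2, so at depth 0 the ball about a corner covers the square and \<open>h\<close> stays in one
  member. Small commuting squares are then pasted back together.\<close>

lemma path_value_square:
  fixes h :: "real \<times> real \<Rightarrow> 'a"
  assumes "continuous_on square h" "h ` square \<subseteq> total" "meshed \<U> I square e h" "2 < 2 ^ n * e"
  shows "g_comp D (path_value (\<lambda>t. h (1, t))) (path_value (\<lambda>t. h (t, 0)))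
       = g_comp D (path_value (\<lambda>t. h (t, 1))) (path_value (\<lambda>t. h (0, t)))"
  using assms
proof (induction n arbitrary: h e)
  case 0
  have "dist (0, 0) (s, t) \<le> sqrt 2" if "s \<in> {0..1}" "t \<in> {0..1}" for s t :: real
  proof -
    have "s\<^sup>2 + t\<^sup>2 \<le> 1 + 1"
      using that by (intro add_mono power_le_one) auto
    then show ?thesis
      by (simp add: dist_prod_def dist_real_def)
  qed
  moreover have "sqrt 2 < e"
    using 0(4) sqrt2_less_2 by simp
  ultimately have "square \<subseteq> ball (0, 0) e"
    by (force simp: mem_ball)
  then obtain i where i: "i \<in> I" "h ` square \<subseteq> \<U> i"
    using meshed_whole[OF 0(3), of "(0, 0)"] by auto
  note edge = path_edge[OF 0(1) i(2)]
  \<comment> \<open>Both routes around the square join the same corners of a convex set, hence their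
    images are homotopic inside the member.\<close>
  have "homotopic_paths (\<U> i) (h \<circ> ((\<lambda>t. (t, 0)) +++ (\<lambda>t. (1, t)))) (h \<circ> ((\<lambda>t. (0, t)) +++ (\<lambda>t. (t, 1))))"
  proof (rule homotopic_paths_reparam_convex[where C = square])
    have [simp]: "path (\<lambda>t. (a::real, t::real))" "path (\<lambda>t. (t::real, a::real))" for a
      by (auto simp: path_def intro!: continuous_intros)
    show "path ((\<lambda>t. (t::real, 0::real)) +++ (\<lambda>t. (1, t)))" "path ((\<lambda>t. (0::real, t::real)) +++ (\<lambda>t. (t, 1)))"
      by (auto intro!: path_join_imp simp: pathstart_def pathfinish_def)
    show "path_image ((\<lambda>t. (t, 0)) +++ (\<lambda>t. (1, t))) \<subseteq> square" "path_image ((\<lambda>t. (0, t)) +++ (\<lambda>t. (t, 1))) \<subseteq> square"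
      by (rule subset_path_image_join; auto simp: path_image_def)+
    show "convex square"
      by (intro convex_Times) auto
  qed (use 0 i in \<open>auto simp: pathstart_def pathfinish_def joinpaths_def\<close>)
  then have "path_class (\<U> i) ((\<lambda>t. h (t, 0)) +++ (\<lambda>t. h (1, t))) = path_class (\<U> i) ((\<lambda>t. h (0, t)) +++ (\<lambda>t. h (t, 1)))"
    unfolding path_compose_join by (intro path_class_eqI) (simp add: o_def)
  moreover have "snd (f i) (path_class (\<U> i) ((\<lambda>t. h (t, 0)) +++ (\<lambda>t. h (1, t))))
      = g_comp D (path_value (\<lambda>t. h (1, t))) (path_value (\<lambda>t. h (t, 0)))"
    using functor_Pi1_join[OF is_functor[OF i(1)], of "\<lambda>t. h (t, 0)" "\<lambda>t. h (1, t)"] edge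
    by (simp add: path_value_local[OF i(1)] pathstart_def pathfinish_def)
  moreover have "snd (f i) (path_class (\<U> i) ((\<lambda>t. h (0, t)) +++ (\<lambda>t. h (t, 1))))
      = g_comp D (path_value (\<lambda>t. h (t, 1))) (path_value (\<lambda>t. h (0, t)))"
    using functor_Pi1_join[OF is_functor[OF i(1)], of "\<lambda>t. h (0, t)" "\<lambda>t. h (t, 1)"] edge
    by (simp add: path_value_local[OF i(1)] pathstart_def pathfinish_def)
  ultimately show ?case
    by simp
next
  case (Suc n)
  \<comment> \<open>Edges of the half-size grid, with coordinates counted in halves:
    \<open>?V x y\<close> runs to the right and \<open>?W x y\<close> upwards from the point (x/2,
    y/2).\<close>
  let ?V = "\<lambda>x y. path_value (\<lambda>t. h ((x + t) / 2, y / 2))"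
  let ?W = "\<lambda>x y. path_value (\<lambda>t. h (x / 2, (y + t) / 2))"
  have IH: "g_comp D (?W (a + 1) b) (?V a b) = g_comp D (?V a (b + 1)) (?W a b)"
    if ab: "a \<in> {0..1}" "b \<in> {0..1}" for a b
  proof -
    let ?\<phi> = "\<lambda>z::real \<times> real. ((a + fst z) / 2, (b + snd z) / 2)"
    have sub: "?\<phi> ` square \<subseteq> square"
      using ab by auto
    have "continuous_on square (quarter a b h)"
      unfolding quarter_def
      by (rule continuous_on_compose) (auto intro!: continuous_intros continuous_on_subset[OF Suc.prems(1) sub])
    moreover have "quarter a b h ` square \<subseteq> total"
      using sub Suc.prems(2) unfolding quarter_def image_comp[symmetric] by blast
    moreover have "dist (?\<phi> z) (?\<phi> w) \<le> dist z w / 2" for z w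
    proof -
      have "?\<phi> z - ?\<phi> w = (1 / 2) *\<^sub>R (z - w)"
        by (simp add: prod_eq_iff field_simps)
      then show ?thesis
        by (simp add: dist_norm)
    qed
    then have "meshed \<U> I square (2 * e) (quarter a b h)"
      unfolding quarter_def by (intro meshed_contract[OF Suc.prems(3) sub]) auto
    moreover have "2 < 2 ^ n * (2 * e)"
      using Suc.prems(4) by (simp add: mult.assoc)
    ultimately have "g_comp D (path_value (\<lambda>t. quarter a b h (1, t))) (path_value (\<lambda>t. quarter a b h (t, 0)))
       = g_comp D (path_value (\<lambda>t. quarter a b h (t, 1))) (path_value (\<lambda>t. quarter a b h (0, t)))"
      by (rule Suc.IH)
    then show ?thesis
      by (simp add: quarter_def)
  qed
  have hom: "in_hom D (?V x y) (glue_obj (h (x / 2, y / 2))) (glue_obj (h ((x + 1) / 2, y / 2)))"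
      "in_hom D (?W y x) (glue_obj (h (y / 2, x / 2))) (glue_obj (h (y / 2, (x + 1) / 2)))"
    if "x \<in> {0, 1}" "y \<in> {0, 1, 2}" for x y
  proof -
    have y: "y / 2 \<in> {0..1}" and x: "x \<in> {0..1}"
      using that by auto
    note edge = path_edge[OF Suc.prems(1,2) y]
    have "path (half x (\<lambda>t. h (t, y / 2)))" "path_image (half x (\<lambda>t. h (t, y / 2))) \<subseteq> total"
      "path (half x (\<lambda>t. h (y / 2, t)))" "path_image (half x (\<lambda>t. h (y / 2, t))) \<subseteq> total"
      using edge path_half[OF _ x] path_image_half[OF x] by (blast, blast, blast, blast)
    from path_value_in_hom[OF this(1,2)] path_value_in_hom[OF this(3,4)]
    show "in_hom D (?V x y) (glue_obj (h (x / 2, y / 2))) (glue_obj (h ((x + 1) / 2, y / 2)))"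
      "in_hom D (?W y x) (glue_obj (h (y / 2, x / 2))) (glue_obj (h (y / 2, (x + 1) / 2)))"
      by (simp_all add: half_def pathstart_def pathfinish_def)
  qed
  \<comment> \<open>A side of the full square at \<open>a\<close> has grid coordinate
    \<open>2 * a\<close>, since grid coordinates count halves.\<close>
  have split: "path_value (\<lambda>t. h (a, t)) = g_comp D (?W (2 * a) 1) (?W (2 * a) 0)"
    "path_value (\<lambda>t. h (t, a)) = g_comp D (?V 1 (2 * a)) (?V 0 (2 * a))" if "a \<in> {0..1}" for a
    using path_value_half[OF path_edge(1,2)[OF Suc.prems(1,2) that]]
      path_value_half[OF path_edge(3,4)[OF Suc.prems(1,2) that]]
    by (simp_all add: half_def)
  note homs = hom[of 0 0] hom[of 0 1] hom[of 0 2] hom[of 1 0] hom[of 1 1] hom[of 1 2]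
  \<comment> \<open>The order of these facts is that of the hypotheses of
    \<open>paste_squares\<close>: rows from bottom to top, then columns from left to right.\<close>
  have hV: "in_hom D (?V 0 0) (glue_obj (h (0, 0))) (glue_obj (h (1 / 2, 0)))"
    "in_hom D (?V 1 0) (glue_obj (h (1 / 2, 0))) (glue_obj (h (1, 0)))"
    "in_hom D (?V 0 1) (glue_obj (h (0, 1 / 2))) (glue_obj (h (1 / 2, 1 / 2)))"
    "in_hom D (?V 1 1) (glue_obj (h (1 / 2, 1 / 2))) (glue_obj (h (1, 1 / 2)))"
    "in_hom D (?V 0 2) (glue_obj (h (0, 1))) (glue_obj (h (1 / 2, 1)))"
    "in_hom D (?V 1 2) (glue_obj (h (1 / 2, 1))) (glue_obj (h (1, 1)))"
    using homs(1,3,5,7,9,11) by simp_all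
  have hW: "in_hom D (?W 0 0) (glue_obj (h (0, 0))) (glue_obj (h (0, 1 / 2)))"
    "in_hom D (?W 0 1) (glue_obj (h (0, 1 / 2))) (glue_obj (h (0, 1)))"
    "in_hom D (?W 1 0) (glue_obj (h (1 / 2, 0))) (glue_obj (h (1 / 2, 1 / 2)))"
    "in_hom D (?W 1 1) (glue_obj (h (1 / 2, 1 / 2))) (glue_obj (h (1 / 2, 1)))"
    "in_hom D (?W 2 0) (glue_obj (h (1, 0))) (glue_obj (h (1, 1 / 2)))"
    "in_hom D (?W 2 1) (glue_obj (h (1, 1 / 2))) (glue_obj (h (1, 1)))"
    using homs(2,4,6,8,10,12) by simp_all
  have sq: "g_comp D (?W 1 0) (?V 0 0) = g_comp D (?V 0 1) (?W 0 0)"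
    "g_comp D (?W 2 0) (?V 1 0) = g_comp D (?V 1 1) (?W 1 0)"
    "g_comp D (?W 1 1) (?V 0 1) = g_comp D (?V 0 2) (?W 0 1)"
    "g_comp D (?W 2 1) (?V 1 1) = g_comp D (?V 1 2) (?W 1 1)"
    using IH[of 0 0] IH[of 1 0] IH[of 0 1] IH[of 1 1] by simp_all
  show ?case
    using paste_squares[OF hV hW sq] split(1)[of 0] split(1)[of 1] split(2)[of 0] split(2)[of 1] by simp
qed

text \<open>A homotopy with fixed endpoints is a square whose bottom and top edges are constant.
  These have identity values, so commutativity of the square leaves the equality of its two vertical
  sides.\<close>

lemma path_value_homotopic:
  assumes "homotopic_paths total p q"
  shows "path_value p = path_value q"
proof -
  obtain h where h: "continuous_on square h" "h ` square \<subseteq> total"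
    and h0: "\<And>t. t \<in> {0..1} \<Longrightarrow> h (0, t) = p t" and h1: "\<And>t. t \<in> {0..1} \<Longrightarrow> h (1, t) = q t"
    and ends: "\<And>t. t \<in> {0..1} \<Longrightarrow> h (t, 0) = pathstart p \<and> h (t, 1) = pathfinish p"
    using assms unfolding homotopic_paths by (fastforce simp: pathstart_def pathfinish_def)
  have p: "path p" "path_image p \<subseteq> total" and q: "path q" "path_image q \<subseteq> total"
    using homotopic_paths_imp_path[OF assms] homotopic_paths_imp_subset[OF assms] by auto
  have e: "pathstart q = pathstart p" "pathfinish q = pathfinish p"
    using assms homotopic_paths_imp_pathstart homotopic_paths_imp_pathfinish by metis+
  obtain e where "e > 0" "meshed \<U> I square e h"
    using meshed_exists[of square h \<U> I] h open_cover by (auto simp: total_def intro: compact_Times)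
  moreover obtain n where "2 / e < 2 ^ n"
    using real_arch_pow[of 2 "2 / e"] by auto
  ultimately have "g_comp D (path_value (\<lambda>t. h (1, t))) (path_value (\<lambda>t. h (t, 0)))
       = g_comp D (path_value (\<lambda>t. h (t, 1))) (path_value (\<lambda>t. h (0, t)))"
    using h by (intro path_value_square[of h e n]) (auto simp: field_simps)
  moreover have "path_value (\<lambda>t. h (0, t)) = path_value p" "path_value (\<lambda>t. h (1, t)) = path_value q"
    "path_value (\<lambda>t. h (t, 0)) = path_value (\<lambda>t. pathstart p)"
    "path_value (\<lambda>t. h (t, 1)) = path_value (\<lambda>t. pathfinish p)"
    by (rule path_value_cong; simp add: h0 h1 ends)+
  moreover have "pathstart p \<in> total" "pathfinish p \<in> total"
    using p(2) pathstart_in_path_image pathfinish_in_path_image by blast+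
  ultimately have "g_comp D (path_value q) (g_id D (glue_obj (pathstart p)))
      = g_comp D (g_id D (glue_obj (pathfinish p))) (path_value p)"
    by (simp add: path_value_const)
  then show ?thesis
    using comp_id_left[OF path_value_in_hom[OF p]] comp_id_right[OF path_value_in_hom[OF q]]
    by (simp add: e)
qed

section \<open>The glued functor and its uniqueness\<close>

definition glue :: "('a, (real \<Rightarrow> 'a) set, 'c, 'd) gfun" where
  "glue = (glue_obj, \<lambda>c. path_value (SOME p. p \<in> c))"

lemma glue_class:
  assumes "path p" "path_image p \<subseteq> total"
  shows "snd glue (path_class total p) = path_value p"
  using path_value_homotopic[OF path_class_rep[OF assms]] by (simp add: glue_def)

lemma is_functor_glue: "is_functor (Pi1 total) D glue"
  unfolding is_functor_def
proof (intro conjI ballI impI)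
  fix x assume "x \<in> g_obj (Pi1 total)"
  then have x: "x \<in> total" by simp
  then obtain i where i: "i \<in> I" "x \<in> \<U> i"
    by (auto simp: total_def)
  then show "fst glue x \<in> g_obj D"
    using is_functor[OF i(1)] by (simp add: glue_def glue_obj_eq is_functor_def)
  show "snd glue (g_id (Pi1 total) x) = g_id D (fst glue x)"
    using x glue_class[of "\<lambda>t. x"] by (simp add: Pi1_id path_image_def path_value_const glue_def)
next
  fix c assume "c \<in> g_arr (Pi1 total)"
  then obtain p where c: "c = path_class total p" and p: "path p" "path_image p \<subseteq> total"
    by (rule Pi1_arrE)
  show "snd glue c \<in> g_arr D" "g_dom D (snd glue c) = fst glue (g_dom (Pi1 total) c)"
    "g_cod D (snd glue c) = fst glue (g_cod (Pi1 total) c)"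
    using path_value_in_hom[OF p] p
    by (simp_all add: c glue_class Pi1_dom_class Pi1_cod_class in_hom_def) (simp_all add: glue_def)
  fix d assume "d \<in> g_arr (Pi1 total)" and cd: "g_cod (Pi1 total) c = g_dom (Pi1 total) d"
  then obtain q where d: "d = path_class total q" and q: "path q" "path_image q \<subseteq> total"
    by (metis Pi1_arrE)
  have "pathfinish p = pathstart q"
    using cd p q by (simp add: c d Pi1_dom_class Pi1_cod_class)
  then show "snd glue (g_comp (Pi1 total) d c) = g_comp D (snd glue d) (snd glue c)"
    using p q by (simp add: c d Pi1_comp_class glue_class path_value_join path_image_join)
qed

text \<open>A functor prescribed on paths inside members is forced everywhere: bisection turns an
  arbitrary arrow into a composite of such paths, and \<open>H\<close> preserves composites.\<close>

lemma glue_unique: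
  assumes H: "is_functor (Pi1 total) D H"
    and loc: "\<And>i p. i \<in> I \<Longrightarrow> path p \<Longrightarrow> path_image p \<subseteq> \<U> i
      \<Longrightarrow> snd H (path_class total p) = snd (f i) (path_class (\<U> i) p)"
    and p: "path p" "path_image p \<subseteq> total"
  shows "snd H (path_class total p) = path_value p"
proof -
  have "snd H (path_class total p) = dyadic_value n p"
    if "small n p" "path p" "path_image p \<subseteq> total" for n p
    using that
  proof (induction n arbitrary: p)
    case 0
    then show ?case
      using loc by (auto simp: local_value_eq)
  next
    case (Suc n)
    have "path (half a p)" "path_image (half a p) \<subseteq> total" if "a \<in> {0..1}" for a
      using Suc.prems path_half[OF _ that] path_image_half[OF that] by blast+
    then show ?case
      using Suc functor_Pi1_join[OF H, of "half 0 p" "half 1 p"] by (simp add: half_ends half_join)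
  qed
  then show ?thesis
    using p by (metis small_exists path_value_eq)
qed

end

section \<open>The cosheaf property\<close>

lemma feq_obj: "feq A F F' \<Longrightarrow> x \<in> g_obj A \<Longrightarrow> fst F x = fst F' x"
  and feq_arr: "feq A F F' \<Longrightarrow> a \<in> g_arr A \<Longrightarrow> snd F a = snd F' a"
  by (simp_all add: feq_def)

lemma is_functor_fcomp: "is_functor A B F \<Longrightarrow> is_functor B C G \<Longrightarrow> is_functor A C (fcomp G F)"
  unfolding is_functor_def fcomp_def by simp

lemma is_functor_inject:
  assumes "i \<in> I"
  shows "is_functor (A i) (coprod I A) (Pair i, Pair i)"
  using assms unfolding is_functor_def coprod_def by simp

definition cotuple :: "('i \<Rightarrow> ('o1, 'm1, 'o2, 'm2) gfun) \<Rightarrow> ('i \<times> 'o1, 'i \<times> 'm1, 'o2, 'm2) gfun" where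
  "cotuple F = ((\<lambda>(i, x). fst (F i) x), (\<lambda>(i, a). snd (F i) a))"

lemma is_functor_cotuple:
  assumes "\<And>i. i \<in> I \<Longrightarrow> is_functor (A i) C (F i)"
  shows "is_functor (coprod I A) C (cotuple F)"
  using assms unfolding is_functor_def coprod_def cotuple_def by fastforce

text \<open>A functor out of a coproduct is checked on the summands; this form reduces functoriality
  of the three cover maps to \<open>is_functor_cotuple\<close>.\<close>

lemma cov_cotuple:
  "cov_left \<rho> \<U> = cotuple (\<lambda>p. fcomp (Pair (fst p), Pair (fst p)) (\<rho> (\<U> (fst p) \<inter> \<U> (snd p)) (\<U> (fst p))))"
  "cov_right \<rho> \<U> = cotuple (\<lambda>p. fcomp (Pair (snd p), Pair (snd p)) (\<rho> (\<U> (fst p) \<inter> \<U> (snd p)) (\<U> (snd p))))"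
  "cov_map \<rho> \<U> U = cotuple (\<lambda>i. \<rho> (\<U> i) U)"
  by (auto simp: cov_left_def cov_right_def cov_map_def cotuple_def fcomp_def fun_eq_iff)

section \<open>The cocone of a cover\<close>

locale open_grpd_functor =
  fixes G :: "'a::topological_space set \<Rightarrow> ('o, 'm) grpd" and \<rho> :: "'a set \<Rightarrow> 'a set \<Rightarrow> ('o, 'm, 'o, 'm) gfun"
  assumes is_open_grpd_functor: "is_open_grpd_functor G \<rho>"
begin

lemma is_functor_rho: "open V \<Longrightarrow> open W \<Longrightarrow> V \<subseteq> W \<Longrightarrow> is_functor (G V) (G W) (\<rho> V W)"
  using is_open_grpd_functor by (simp add: is_open_grpd_functor_def)

lemma rho_rho:
  assumes "open V" "open W" "open Z" "V \<subseteq> W" "W \<subseteq> Z"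
  shows "x \<in> g_obj (G V) \<Longrightarrow> fst (\<rho> W Z) (fst (\<rho> V W) x) = fst (\<rho> V Z) x"
    and "a \<in> g_arr (G V) \<Longrightarrow> snd (\<rho> W Z) (snd (\<rho> V W) a) = snd (\<rho> V Z) a"
  using is_open_grpd_functor assms by (auto simp: is_open_grpd_functor_def feq_def fcomp_def)

lemma is_functor_cov:
  assumes "\<And>i. i \<in> I \<Longrightarrow> open (\<U> i)"
  shows "is_functor (coprod (I \<times> I) (\<lambda>(i, j). G (\<U> i \<inter> \<U> j))) (coprod I (\<lambda>i. G (\<U> i))) (cov_left \<rho> \<U>)"
    and "is_functor (coprod (I \<times> I) (\<lambda>(i, j). G (\<U> i \<inter> \<U> j))) (coprod I (\<lambda>i. G (\<U> i))) (cov_right \<rho> \<U>)"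
proof -
  have "is_functor (G (\<U> i \<inter> \<U> j)) (G (\<U> k)) (\<rho> (\<U> i \<inter> \<U> j) (\<U> k))"
    if "i \<in> I" "j \<in> I" "k = i \<or> k = j" for i j k
    using that assms by (intro is_functor_rho) auto
  then have "is_functor (G (\<U> i \<inter> \<U> j)) (coprod I (\<lambda>i. G (\<U> i))) (fcomp (Pair k, Pair k) (\<rho> (\<U> i \<inter> \<U> j) (\<U> k)))"
    if "i \<in> I" "j \<in> I" "k = i \<or> k = j" for i j k
    using that by (intro is_functor_fcomp[OF _ is_functor_inject[of k I "\<lambda>i. G (\<U> i)"]]) auto
  then show "is_functor (coprod (I \<times> I) (\<lambda>(i, j). G (\<U> i \<inter> \<U> j))) (coprod I (\<lambda>i. G (\<U> i))) (cov_left \<rho> \<U>)"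
    "is_functor (coprod (I \<times> I) (\<lambda>(i, j). G (\<U> i \<inter> \<U> j))) (coprod I (\<lambda>i. G (\<U> i))) (cov_right \<rho> \<U>)"
    unfolding cov_cotuple by (auto intro!: is_functor_cotuple)
qed

lemma is_functor_cov_map:
  assumes "\<And>i. i \<in> I \<Longrightarrow> open (\<U> i)"
  shows "is_functor (coprod I (\<lambda>i. G (\<U> i))) (G (\<Union>i\<in>I. \<U> i)) (cov_map \<rho> \<U> (\<Union>i\<in>I. \<U> i))"
  unfolding cov_cotuple by (rule is_functor_cotuple) (use assms in \<open>auto intro!: is_functor_rho\<close>)

text \<open>By functoriality of \<open>\<rho>\<close>, both composites extend from the intersection
  to the union directly, whichever member they pass through.\<close>

lemma feq_cov_map:
  assumes "\<And>i. i \<in> I \<Longrightarrow> open (\<U> i)"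
  shows "feq (coprod (I \<times> I) (\<lambda>(i, j). G (\<U> i \<inter> \<U> j)))
    (fcomp (cov_map \<rho> \<U> (\<Union>i\<in>I. \<U> i)) (cov_left \<rho> \<U>))
    (fcomp (cov_map \<rho> \<U> (\<Union>i\<in>I. \<U> i)) (cov_right \<rho> \<U>))"
proof -
  have o: "open (\<Union>i\<in>I. \<U> i)"
    using assms by blast
  show ?thesis
    unfolding feq_def coprod_def fcomp_def cov_left_def cov_right_def cov_map_def
    using assms by (auto simp: rho_rho[OF _ _ o _ UN_upper] open_Int)
qed

end

lemma is_cosheaf_Pi1:
  "is_cosheaf (Pi1 :: 'a::topological_space set \<Rightarrow> _) Pi1_incl TYPE('i) TYPE('c \<times> 'd)"
  unfolding is_cosheaf_def is_coequaliser_def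
proof (intro allI impI conjI)
  interpret open_grpd_functor "Pi1 :: 'a set \<Rightarrow> _" Pi1_incl
    by unfold_locales (rule is_open_grpd_functor_Pi1)
  fix U :: "'a set" and I :: "'i set" and \<U>
  assume "open U \<and> (\<forall>i\<in>I. open (\<U> i)) \<and> U = (\<Union>i\<in>I. \<U> i)"
  then have op: "\<And>i. i \<in> I \<Longrightarrow> open (\<U> i)" and U: "U = (\<Union>i\<in>I. \<U> i)"
    by auto
  let ?A = "coprod (I \<times> I) (\<lambda>(i, j). Pi1 (\<U> i \<inter> \<U> j))" and ?B = "coprod I (\<lambda>i. Pi1 (\<U> i))"
  show "is_functor ?A ?B (cov_left Pi1_incl \<U>)" "is_functor ?A ?B (cov_right Pi1_incl \<U>)"
    using is_functor_cov[of I \<U>] op by auto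
  show "is_functor ?B (Pi1 U) (cov_map Pi1_incl \<U> U)"
    using is_functor_cov_map[of I \<U>] op by (simp add: U)
  show "feq ?A (fcomp (cov_map Pi1_incl \<U> U) (cov_left Pi1_incl \<U>)) (fcomp (cov_map Pi1_incl \<U> U) (cov_right Pi1_incl \<U>))"
    using feq_cov_map[of I \<U>] op by (simp add: U)
  fix D :: "('c, 'd) grpd" and F
  assume "is_groupoid D \<and> is_functor ?B D F \<and> feq ?A (fcomp F (cov_left Pi1_incl \<U>)) (fcomp F (cov_right Pi1_incl \<U>))"
  then have D: "is_groupoid D" and F: "is_functor ?B D F"
    and eq: "feq ?A (fcomp F (cov_left Pi1_incl \<U>)) (fcomp F (cov_right Pi1_incl \<U>))"
    by auto
  have obj: "fst F (i, x) = fst F (j, x)" if "i \<in> I" "j \<in> I" "x \<in> \<U> i" "x \<in> \<U> j" for i j x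
  proof -
    have "((i, j), x) \<in> g_obj ?A"
      using that by (simp add: coprod_def)
    from feq_obj[OF eq this] show ?thesis
      by (simp add: fcomp_def cov_left_def cov_right_def)
  qed
  have arr: "snd F (i, path_class (\<U> i) p) = snd F (j, path_class (\<U> j) p)"
    if "i \<in> I" "j \<in> I" "path p" "path_image p \<subseteq> \<U> i" "path_image p \<subseteq> \<U> j" for i j p
  proof -
    \<comment> \<open>A path inside both members is already an arrow over the intersection, and its
      two images are its classes over \<open>\<U> i\<close> and \<open>\<U> j\<close>.\<close>
    have "((i, j), path_class (\<U> i \<inter> \<U> j) p) \<in> g_arr ?A"
      using that by (auto simp: coprod_def intro!: Pi1_arrI)
    from feq_arr[OF eq this] show ?thesis
      using that by (simp add: fcomp_def cov_left_def cov_right_def Pi1_incl_class)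
  qed
  \<comment> \<open>Restricting \<open>F\<close> to the summands yields the family to be glued; that
    \<open>F\<close> equalises the two cover maps makes the family agree on overlaps.\<close>
  define f where "f = (\<lambda>i. fcomp F (Pair i, Pair i))"
  have f: "fst (f i) x = fst F (i, x)" "snd (f i) c = snd F (i, c)" for i x c
    by (simp_all add: f_def fcomp_def)
  interpret g: pi1_gluing D I \<U> f
  proof
    show "is_functor (Pi1 (\<U> i)) D (f i)" if "i \<in> I" for i
      unfolding f_def using is_functor_fcomp[OF is_functor_inject[OF that, of "\<lambda>i. Pi1 (\<U> i)"] F] .
  qed (unfold f, (rule D op obj arr; assumption?)+)
  have U': "U = g.total"
    by (simp add: g.total_def U)
  show "\<exists>H. is_functor (Pi1 U) D H \<and> feq ?B (fcomp H (cov_map Pi1_incl \<U> U)) F \<and>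
      (\<forall>H'. is_functor (Pi1 U) D H' \<and> feq ?B (fcomp H' (cov_map Pi1_incl \<U> U)) F \<longrightarrow> feq (Pi1 U) H' H)"
  proof (intro exI[of _ g.glue] conjI allI impI)
    show "is_functor (Pi1 U) D g.glue"
      by (simp add: U' g.is_functor_glue)
    have "fst g.glue x = fst F (i, x)" if "i \<in> I" "x \<in> \<U> i" for i x
      using that g.glue_obj_eq[of i x] by (simp add: g.glue_def f)
    moreover have "snd g.glue (snd (Pi1_incl (\<U> i) U) c) = snd F (i, c)" if i: "i \<in> I" and c: "c \<in> g_arr (Pi1 (\<U> i))" for i c
    proof -
      obtain p where c: "c = path_class (\<U> i) p" and p: "path p" "path_image p \<subseteq> \<U> i"
        using c by (rule Pi1_arrE)
      have iU: "\<U> i \<subseteq> U"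
        using i by (auto simp: U)
      then have "snd g.glue (path_class U p) = g.path_value p"
        using p unfolding U' by (intro g.glue_class) auto
      then show ?thesis
        using p i g.path_value_local[OF i p] by (simp add: c Pi1_incl_class iU f)
    qed
    ultimately show "feq ?B (fcomp g.glue (cov_map Pi1_incl \<U> U)) F"
      by (auto simp: feq_def coprod_def fcomp_def cov_map_def)
    fix H' assume H: "is_functor (Pi1 U) D H' \<and> feq ?B (fcomp H' (cov_map Pi1_incl \<U> U)) F"
    have Ho: "fst H' x = fst F (i, x)" if "i \<in> I" "x \<in> \<U> i" for i x
      using feq_obj[OF conjunct2[OF H], of "(i, x)"] that by (simp add: coprod_def fcomp_def cov_map_def)
    have Ha: "snd H' (path_class U p) = snd F (i, path_class (\<U> i) p)"
      if "i \<in> I" "path p" "path_image p \<subseteq> \<U> i" for i p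
    proof -
      have "(i, path_class (\<U> i) p) \<in> g_arr ?B"
        using that by (auto simp: coprod_def intro!: Pi1_arrI)
      from feq_arr[OF conjunct2[OF H] this]
      have "snd H' (snd (Pi1_incl (\<U> i) U) (path_class (\<U> i) p)) = snd F (i, path_class (\<U> i) p)"
        by (simp add: fcomp_def cov_map_def)
      moreover have "\<U> i \<subseteq> U"
        using that by (auto simp: U)
      ultimately show ?thesis
        using that by (simp add: Pi1_incl_class)
    qed
    show "feq (Pi1 U) H' g.glue"
      unfolding feq_def
    proof (intro conjI ballI)
      fix x assume "x \<in> g_obj (Pi1 U)"
      then obtain i where "i \<in> I" "x \<in> \<U> i"
        by (auto simp: U)
      then show "fst H' x = fst g.glue x"
        using Ho[of i x] g.glue_obj_eq[of i x] by (simp add: g.glue_def f)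
    next
      fix c assume "c \<in> g_arr (Pi1 U)"
      then obtain p where c: "c = path_class U p" and p: "path p" "path_image p \<subseteq> U"
        by (rule Pi1_arrE)
      have "snd H' (path_class U p) = g.path_value p"
        unfolding U' by (rule g.glue_unique) (use H Ha p in \<open>auto simp: U' f\<close>)
      then show "snd H' c = snd g.glue c"
        using p g.glue_class[of p] by (simp add: c U')
    qed
  qed
qed

section \<open>Descent\<close>

definition hom_component :: "('o1, 'm1, 'o2, 'm2) natarr \<Rightarrow> 'o1 \<Rightarrow> 'm2" where
  "hom_component a = snd (snd a)"

lemma hom_component_simp [simp]: "hom_component (F, F', \<theta>) = \<theta>"
  by (simp add: hom_component_def)

lemma frestr_simps:
  "x \<in> g_obj A \<Longrightarrow> fst (frestr A F) x = fst F x"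
  "a \<in> g_arr A \<Longrightarrow> snd (frestr A F) a = snd F a"
  by (simp_all add: frestr_def)

lemma frestr_frestr [simp]: "frestr A (frestr A F) = frestr A F"
  by (simp add: frestr_def)

text \<open>Objects of \<open>hom_grpd\<close> are functors with a default value off the carriers,
  so that their equality means agreement on the carriers.\<close>

lemma frestr_eq_iff: "frestr A F = frestr A F' \<longleftrightarrow> feq A F F'"
  unfolding frestr_def feq_def by (auto simp: restrict_def fun_eq_iff)

lemma hom_obj: "F \<in> g_obj (hom_grpd A D) \<longleftrightarrow> is_functor A D F \<and> F = frestr A F"
  by (simp add: hom_grpd_def)

lemma hom_arr: "(F, F', \<theta>) \<in> g_arr (hom_grpd A D) \<longleftrightarrow>
    F \<in> g_obj (hom_grpd A D) \<and> F' \<in> g_obj (hom_grpd A D) \<and> is_nat A D F F' \<theta> \<and> \<theta> \<in> extensional (g_obj A)"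
  by (auto simp: hom_grpd_def)

lemma hom_simps [simp]:
  "g_dom (hom_grpd A D) (F, F', \<theta>) = F"
  "g_cod (hom_grpd A D) (F, F', \<theta>) = F'"
  "g_id (hom_grpd A D) F = (F, F, \<lambda>x\<in>g_obj A. g_id D (fst F x))"
  "g_comp (hom_grpd A D) (F1, F2, \<theta>') (F0, F1', \<theta>) = (F0, F2, \<lambda>x\<in>g_obj A. g_comp D (\<theta>' x) (\<theta> x))"
  by (simp_all add: hom_grpd_def)

text \<open>Functoriality only looks at values on the carriers; endpoints, identities and composites
  stay there because \<open>A\<close> is a groupoid.\<close>

lemma is_functor_cong:
  assumes "feq A F F'" "is_groupoid A"
  shows "is_functor A D F \<longleftrightarrow> is_functor A D F'"
proof -
  have "is_functor A D F'" if "feq A F F'" "is_functor A D F" for F F' :: "('a, 'b, 'c, 'd) gfun"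
  proof -
    have eq: "\<And>x. x \<in> g_obj A \<Longrightarrow> fst F' x = fst F x" "\<And>a. a \<in> g_arr A \<Longrightarrow> snd F' a = snd F a"
      using that(1) by (simp_all add: feq_def)
    show ?thesis
      using that(2) assms(2) unfolding is_functor_def is_groupoid_def by (simp add: eq)
  qed
  moreover have "feq A F' F"
    using assms(1) by (simp add: feq_def)
  ultimately show ?thesis
    using assms(1) by blast
qed

lemma feq_frestr: "feq A (frestr A F) F"
  by (simp add: feq_def frestr_def)

lemma is_nat_restrict:
  assumes "is_groupoid A"
  shows "is_nat A D F F' (restrict \<theta> (g_obj A)) \<longleftrightarrow> is_nat A D F F' \<theta>"
  using assms unfolding is_nat_def is_groupoid_def by simp

lemma is_natD:
  assumes "is_nat A D F F' \<theta>"
  shows "x \<in> g_obj A \<Longrightarrow> in_hom D (\<theta> x) (fst F x) (fst F' x)"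
    and "a \<in> g_arr A \<Longrightarrow> g_comp D (\<theta> (g_cod A a)) (snd F a) = g_comp D (snd F' a) (\<theta> (g_dom A a))"
  using assms by (auto simp: is_nat_def in_hom_def)

lemma ares_simp: "ares G \<rho> V W (F, F', \<theta>) = (fres G \<rho> V W F, fres G \<rho> V W F', \<lambda>x\<in>g_obj (G V). \<theta> (fst (\<rho> V W) x))"
  by (simp add: ares_def)

section \<open>Gluing in a cosheaf whose objects are points\<close>

locale descent = groupoid D + open_grpd_functor G \<rho>
  for D :: "('c, 'd) grpd" and G :: "'a::topological_space set \<Rightarrow> ('a, 'm) grpd" and \<rho> +
  fixes I :: "'i set" and \<U> :: "'i \<Rightarrow> 'a set" and U :: "'a set"
  assumes cosheaf: "is_cosheaf G \<rho> TYPE('i) TYPE('c \<times> 'd)"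
    and obj [simp]: "g_obj (G V) = V"
    and rho_obj [simp]: "fst (\<rho> V W) x = x"
    and open_cover: "i \<in> I \<Longrightarrow> open (\<U> i)"
    and cover: "U = (\<Union>i\<in>I. \<U> i)"
begin

lemma open_U: "open U"
  using open_cover by (auto simp: cover)

lemma sub_U: "i \<in> I \<Longrightarrow> \<U> i \<subseteq> U"
  by (auto simp: cover)

lemma groupoid_G: "open V \<Longrightarrow> groupoid (G V)"
  using is_open_grpd_functor by unfold_locales (simp add: is_open_grpd_functor_def)

lemma rho_arr:
  assumes "open V" "open W" "V \<subseteq> W" "a \<in> g_arr (G V)"
  shows "snd (\<rho> V W) a \<in> g_arr (G W)" "g_dom (G W) (snd (\<rho> V W) a) = g_dom (G V) a"
    "g_cod (G W) (snd (\<rho> V W) a) = g_cod (G V) a"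
  using is_functor_rho[OF assms(1-3)] assms(4) by (auto simp: is_functor_def)

lemma fres_obj: "x \<in> V \<Longrightarrow> fst (fres G \<rho> V W F) x = fst F x"
  and fres_arr: "a \<in> g_arr (G V) \<Longrightarrow> snd (fres G \<rho> V W F) a = snd F (snd (\<rho> V W) a)"
  by (simp_all add: fres_def frestr_def fcomp_def)

lemma fres_hom_obj:
  assumes "open V" "open W" "V \<subseteq> W" "is_functor (G W) D F"
  shows "fres G \<rho> V W F \<in> g_obj (hom_grpd (G V) D)"
proof -
  have "is_functor (G V) D (fcomp F (\<rho> V W))"
    using assms is_functor_rho by (blast intro: is_functor_fcomp)
  then show ?thesis
    by (simp add: hom_obj fres_def is_functor_cong[OF feq_frestr groupoid.is_groupoid[OF groupoid_G[OF assms(1)]]])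
qed

lemma fres_fres:
  assumes "open V" "open W" "open Z" "V \<subseteq> W" "W \<subseteq> Z"
  shows "fres G \<rho> V W (fres G \<rho> W Z F) = fres G \<rho> V Z F"
  unfolding fres_def frestr_eq_iff
  using assms rho_rho(2)[OF assms] by (auto simp: feq_def fcomp_def frestr_simps rho_arr)

text \<open>The coequaliser property in terms of families: a functor out of the coproduct is a
  family \<open>L\<close>, and equalising the two cover maps is strict agreement on overlaps.
  Uniqueness is stated after \<open>frestr\<close>, the normal form of objects of
  \<open>hom_grpd\<close>.\<close>

lemma glue_exists:
  assumes L: "\<And>i. i \<in> I \<Longrightarrow> is_functor (G (\<U> i)) D (L i)"
    and Lo: "\<And>i j x. i \<in> I \<Longrightarrow> j \<in> I \<Longrightarrow> x \<in> \<U> i \<inter> \<U> j \<Longrightarrow> fst (L i) x = fst (L j) x"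
    and La: "\<And>i j a. i \<in> I \<Longrightarrow> j \<in> I \<Longrightarrow> a \<in> g_arr (G (\<U> i \<inter> \<U> j))
      \<Longrightarrow> snd (L i) (snd (\<rho> (\<U> i \<inter> \<U> j) (\<U> i)) a) = snd (L j) (snd (\<rho> (\<U> i \<inter> \<U> j) (\<U> j)) a)"
  obtains H where "H \<in> g_obj (hom_grpd (G U) D)"
    "\<And>i. i \<in> I \<Longrightarrow> feq (G (\<U> i)) (fcomp H (\<rho> (\<U> i) U)) (L i)"
    "\<And>H'. is_functor (G U) D H' \<Longrightarrow> (\<And>i. i \<in> I \<Longrightarrow> feq (G (\<U> i)) (fcomp H' (\<rho> (\<U> i) U)) (L i))
      \<Longrightarrow> frestr (G U) H' = H"
proof -
  let ?A = "coprod (I \<times> I) (\<lambda>(i, j). G (\<U> i \<inter> \<U> j))" and ?B = "coprod I (\<lambda>i. G (\<U> i))"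
  have co: "is_coequaliser ?A ?B (cov_left \<rho> \<U>) (cov_right \<rho> \<U>) (G U) (cov_map \<rho> \<U> U) TYPE('c \<times> 'd)"
    using cosheaf open_U open_cover cover unfolding is_cosheaf_def by blast
  have "is_functor ?B D (cotuple L)"
    using L by (rule is_functor_cotuple)
  moreover have "feq ?A (fcomp (cotuple L) (cov_left \<rho> \<U>)) (fcomp (cotuple L) (cov_right \<rho> \<U>))"
    unfolding feq_def coprod_def fcomp_def cov_left_def cov_right_def cotuple_def
    using Lo La by fastforce
  ultimately obtain H where H: "is_functor (G U) D H" "feq ?B (fcomp H (cov_map \<rho> \<U> U)) (cotuple L)"
    and uniq: "\<And>H'. is_functor (G U) D H' \<Longrightarrow> feq ?B (fcomp H' (cov_map \<rho> \<U> U)) (cotuple L) \<Longrightarrow> feq (G U) H' H"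
    using co is_groupoid unfolding is_coequaliser_def by blast
  have loc: "feq ?B (fcomp H (cov_map \<rho> \<U> U)) (cotuple L)
      \<longleftrightarrow> (\<forall>i\<in>I. feq (G (\<U> i)) (fcomp H (\<rho> (\<U> i) U)) (L i))" for H
    by (auto simp: feq_def coprod_def fcomp_def cov_map_def cotuple_def)
  show thesis
  proof
    show "frestr (G U) H \<in> g_obj (hom_grpd (G U) D)"
      using H(1)
      by (simp add: hom_obj is_functor_cong[OF feq_frestr groupoid.is_groupoid[OF groupoid_G[OF open_U]]])
    show "feq (G (\<U> i)) (fcomp (frestr (G U) H) (\<rho> (\<U> i) U)) (L i)" if "i \<in> I" for i
    proof -
      have "feq (G (\<U> i)) (fcomp H (\<rho> (\<U> i) U)) (L i)"
        using H(2) loc that by blast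
      then show ?thesis
        using that rho_arr(1)[OF open_cover open_U sub_U] sub_U[OF that]
        by (auto simp: feq_def fcomp_def frestr_simps)
    qed
    show "frestr (G U) H' = frestr (G U) H" if "is_functor (G U) D H'"
      "\<And>i. i \<in> I \<Longrightarrow> feq (G (\<U> i)) (fcomp H' (\<rho> (\<U> i) U)) (L i)" for H'
      using uniq that loc by (simp add: frestr_eq_iff)
  qed
qed

text \<open>The restrictions of \<open>F'\<close> form a compatible family which both functors glue,
  so uniqueness of gluing identifies them.\<close>

lemma functor_eqI:
  assumes "is_functor (G U) D F" "is_functor (G U) D F'"
    and "\<And>i. i \<in> I \<Longrightarrow> feq (G (\<U> i)) (fcomp F (\<rho> (\<U> i) U)) (fcomp F' (\<rho> (\<U> i) U))"
  shows "feq (G U) F F'"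
proof -
  let ?L = "\<lambda>i. fcomp F' (\<rho> (\<U> i) U)"
  have "frestr (G U) F = frestr (G U) F'"
  proof (rule glue_exists[of ?L])
    show "is_functor (G (\<U> i)) D (?L i)" if "i \<in> I" for i
      using is_functor_fcomp[OF is_functor_rho[OF open_cover[OF that] open_U sub_U[OF that]] assms(2)] .
    show "fst (?L i) x = fst (?L j) x" for i j x
      by (simp add: fcomp_def)
    show "snd (?L i) (snd (\<rho> (\<U> i \<inter> \<U> j) (\<U> i)) a) = snd (?L j) (snd (\<rho> (\<U> i \<inter> \<U> j) (\<U> j)) a)"
      if "i \<in> I" "j \<in> I" "a \<in> g_arr (G (\<U> i \<inter> \<U> j))" for i j a
      using that rho_rho(2)[of "\<U> i \<inter> \<U> j" _ U a] open_cover open_U sub_U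
      by (simp add: open_Int fcomp_def)
  next
    fix H
    assume H: "\<And>H'. is_functor (G U) D H' \<Longrightarrow> (\<And>i. i \<in> I \<Longrightarrow> feq (G (\<U> i)) (fcomp H' (\<rho> (\<U> i) U)) (?L i))
      \<Longrightarrow> frestr (G U) H' = H"
    have "frestr (G U) F = H"
      using assms(1,3) by (rule H)
    moreover have "frestr (G U) F' = H"
      using assms(2) by (rule H) (simp add: feq_def)
    ultimately show "frestr (G U) F = frestr (G U) F'"
      by simp
  qed
  then show ?thesis
    by (simp add: frestr_eq_iff)
qed

text \<open>An abstract cosheaf offers no explicit decomposition of the arrows of \<open>G U\<close>
  into local ones, so naturality over \<open>U\<close> is turned into an equality of two functors,
  to which uniqueness of gluing applies.\<close>

lemma is_natI_local:
  assumes F: "is_functor (G U) D F" and F': "is_functor (G U) D F'"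
    and hom: "\<And>x. x \<in> U \<Longrightarrow> in_hom D (\<theta> x) (fst F x) (fst F' x)"
    and nat: "\<And>i a. i \<in> I \<Longrightarrow> a \<in> g_arr (G (\<U> i)) \<Longrightarrow>
      g_comp D (\<theta> (g_cod (G (\<U> i)) a)) (snd F (snd (\<rho> (\<U> i) U) a))
      = g_comp D (snd F' (snd (\<rho> (\<U> i) U) a)) (\<theta> (g_dom (G (\<U> i)) a))"
  shows "is_nat (G U) D F F' \<theta>"
proof -
  have "\<exists>k. in_hom D k (fst F' x) (fst F x) \<and> g_comp D k (\<theta> x) = g_id D (fst F x)
      \<and> g_comp D (\<theta> x) k = g_id D (fst F' x)" if "x \<in> U" for x
    using obtain_inverse[OF hom[OF that]] by metis
  then obtain \<kappa> where k: "\<And>x. x \<in> U \<Longrightarrow> in_hom D (\<kappa> x) (fst F' x) (fst F x)"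
    and k1: "\<And>x. x \<in> U \<Longrightarrow> g_comp D (\<kappa> x) (\<theta> x) = g_id D (fst F x)"
    and k2: "\<And>x. x \<in> U \<Longrightarrow> g_comp D (\<theta> x) (\<kappa> x) = g_id D (fst F' x)"
    by metis
  interpret GU: groupoid "G U"
    by (rule groupoid_G[OF open_U])
  have inU: "x \<in> U" "y \<in> U" if "in_hom (G U) a x y" for a x y
    using GU.in_hom_obj[OF that] by simp_all
  \<comment> \<open>Conjugating F' by the isomorphisms \<theta> gives a functor that agrees with F locally, hence globally.\<close>
  define K where "K = (fst F, \<lambda>a. g_comp D (\<kappa> (g_cod (G U) a)) (g_comp D (snd F' a) (\<theta> (g_dom (G U) a))))"
  have K: "snd K a = g_comp D (\<kappa> y) (g_comp D (snd F' a) (\<theta> x))" if "in_hom (G U) a x y" for a x y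
    using that by (simp add: K_def in_hom_def)
  have Khom: "in_hom D (snd K a) (fst F x) (fst F y)" if a: "in_hom (G U) a x y" for a x y
    using in_hom_comp[OF in_hom_comp[OF hom[OF inU(1)[OF a]] functor_in_hom[OF F' a]] k[OF inU(2)[OF a]]]
    by (simp add: K[OF a])
  have theta_K: "g_comp D (\<theta> y) (snd K a) = g_comp D (snd F' a) (\<theta> x)" if a: "in_hom (G U) a x y" for a x y
  proof -
    note f = in_hom_comp[OF hom[OF inU(1)[OF a]] functor_in_hom[OF F' a]]
    show ?thesis
      using comp_assoc[OF f k[OF inU(2)[OF a]] hom[OF inU(2)[OF a]]] inU[OF a]
      by (simp add: K[OF a] k2 comp_id_left[OF f])
  qed
  \<comment> \<open>Naturality at \<open>a\<close> amounts to equality of \<open>K\<close> and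
    \<open>F\<close> at \<open>a\<close>: local naturality enters through this fact, and global
    naturality is read back through \<open>theta_K\<close>.\<close>
  have FK: "snd K a = snd F a"
    if a: "in_hom (G U) a x y" and e: "g_comp D (\<theta> y) (snd F a) = g_comp D (snd F' a) (\<theta> x)" for a x y
    using comp_cancel_left[OF Khom[OF a] functor_in_hom[OF F a] hom[OF inU(2)[OF a]]] theta_K[OF a] e by simp
  have "is_functor (G U) D K"
    unfolding is_functor_def
  proof (intro conjI ballI impI)
    fix x assume "x \<in> g_obj (G U)"
    then have x: "x \<in> U" by simp
    then show "fst K x \<in> g_obj D"
      using F by (simp add: K_def is_functor_def)
    have "in_hom (G U) (g_id (G U) x) x x"
      using GU.in_hom_id x by simp
    then show "snd K (g_id (G U) x) = g_id D (fst K x)"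
    proof -
      assume "in_hom (G U) (g_id (G U) x) x x"
      note K[OF this]
      moreover have "snd F' (g_id (G U) x) = g_id D (fst F' x)"
        using F' x by (simp add: is_functor_def)
      ultimately have "snd K (g_id (G U) x) = g_id D (fst F x)"
        using x by (simp add: comp_id_left[OF hom] k1)
      then show ?thesis
        by (simp add: K_def)
    qed
  next
    fix a assume a: "a \<in> g_arr (G U)"
    then have ah: "in_hom (G U) a (g_dom (G U) a) (g_cod (G U) a)"
      by (simp add: in_hom_def)
    show "snd K a \<in> g_arr D" "g_dom D (snd K a) = fst K (g_dom (G U) a)" "g_cod D (snd K a) = fst K (g_cod (G U) a)"
      using Khom[OF ah] by (simp_all add: in_hom_def) (simp_all add: K_def)
    fix b assume b: "b \<in> g_arr (G U)" and ab: "g_cod (G U) a = g_dom (G U) b"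
    define x y z where "x = g_dom (G U) a" and "y = g_cod (G U) a" and "z = g_cod (G U) b"
    have ah: "in_hom (G U) a x y" and bh: "in_hom (G U) b y z"
      using a b ab by (auto simp: in_hom_def x_def y_def z_def)
    note abh = GU.in_hom_comp[OF ah bh]
    \<comment> \<open>Composites are compared after \<open>\<theta> z\<close>, which is
      invertible.\<close>
    have "g_comp D (\<theta> z) (snd K (g_comp (G U) b a)) = g_comp D (snd F' (g_comp (G U) b a)) (\<theta> x)"
      by (rule theta_K[OF abh])
    also have "\<dots> = g_comp D (snd F' b) (g_comp D (snd F' a) (\<theta> x))"
      using comp_assoc[OF hom[OF inU(1)[OF ah]] functor_in_hom[OF F' ah] functor_in_hom[OF F' bh]]
      by (simp add: functor_comp[OF F' ah bh])
    also have "\<dots> = g_comp D (snd F' b) (g_comp D (\<theta> y) (snd K a))"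
      by (simp add: theta_K[OF ah])
    also have "\<dots> = g_comp D (g_comp D (\<theta> z) (snd K b)) (snd K a)"
      using comp_assoc[OF Khom[OF ah] hom[OF inU(2)[OF ah]] functor_in_hom[OF F' bh]]
      by (simp add: theta_K[OF bh])
    also have "\<dots> = g_comp D (\<theta> z) (g_comp D (snd K b) (snd K a))"
      by (rule comp_assoc[OF Khom[OF ah] Khom[OF bh] hom[OF inU(2)[OF bh]]])
    finally show "snd K (g_comp (G U) b a) = g_comp D (snd K b) (snd K a)"
      by (rule comp_cancel_left[OF Khom[OF abh] in_hom_comp[OF Khom[OF ah] Khom[OF bh]] hom[OF inU(2)[OF bh]]])
  qed
  moreover have "feq (G (\<U> i)) (fcomp K (\<rho> (\<U> i) U)) (fcomp F (\<rho> (\<U> i) U))" if i: "i \<in> I" for i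
  proof -
    have "snd K (snd (\<rho> (\<U> i) U) a) = snd F (snd (\<rho> (\<U> i) U) a)" if a: "a \<in> g_arr (G (\<U> i))" for a
      using rho_arr[OF open_cover[OF i] open_U sub_U[OF i] a] nat[OF i a]
      by (intro FK[of _ "g_dom (G (\<U> i)) a" "g_cod (G (\<U> i)) a"]) (simp_all add: in_hom_def)
    then show ?thesis
      by (simp add: feq_def fcomp_def) (simp add: K_def)
  qed
  ultimately have eq: "feq (G U) K F"
    using F by (intro functor_eqI)
  show ?thesis
    unfolding is_nat_def
  proof (intro conjI ballI)
    fix x assume "x \<in> g_obj (G U)"
    then show "\<theta> x \<in> g_arr D" "g_dom D (\<theta> x) = fst F x" "g_cod D (\<theta> x) = fst F' x"
      using hom by (simp_all add: in_hom_def)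
  next
    fix a assume a: "a \<in> g_arr (G U)"
    then show "g_comp D (\<theta> (g_cod (G U) a)) (snd F a) = g_comp D (snd F' a) (\<theta> (g_dom (G U) a))"
      using theta_K[of a "g_dom (G U) a" "g_cod (G U) a"] feq_arr[OF eq a] by (simp add: in_hom_def)
  qed
qed

section \<open>Descent data in pointwise form\<close>

abbreviation desc :: "(('i, 'a, 'm, 'c, 'd) descobj, ('i, 'a, 'm, 'c, 'd) descarr) grpd" where
  "desc \<equiv> desc_grpd G \<rho> I \<U> D"

definition transition :: "('i, 'a, 'm, 'c, 'd) descobj \<Rightarrow> 'i \<Rightarrow> 'i \<Rightarrow> 'a \<Rightarrow> 'd" where
  "transition d i j = hom_component (snd d (i, j))"

lemma open_Int_cover: "i \<in> I \<Longrightarrow> j \<in> I \<Longrightarrow> open (\<U> i \<inter> \<U> j)"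
  by (simp add: open_Int open_cover)

lemma desc_functor:
  assumes "d \<in> g_obj desc" "i \<in> I"
  shows "fst d i \<in> g_obj (hom_grpd (G (\<U> i)) D)" "is_functor (G (\<U> i)) D (fst d i)"
  using assms by (auto simp: desc_grpd_def desc_obj_def hom_obj)

lemma desc_transition:
  assumes "d \<in> g_obj desc" "i \<in> I" "j \<in> I"
  shows "snd d (i, j) = (fres G \<rho> (\<U> i \<inter> \<U> j) (\<U> i) (fst d i), fres G \<rho> (\<U> i \<inter> \<U> j) (\<U> j) (fst d j), transition d i j)"
    and "is_nat (G (\<U> i \<inter> \<U> j)) D (fres G \<rho> (\<U> i \<inter> \<U> j) (\<U> i) (fst d i))
      (fres G \<rho> (\<U> i \<inter> \<U> j) (\<U> j) (fst d j)) (transition d i j)"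
proof -
  obtain F F' \<theta> where 1: "snd d (i, j) = (F, F', \<theta>)"
    by (cases "snd d (i, j)")
  have "snd d (i, j) \<in> g_arr (hom_grpd (G (\<U> i \<inter> \<U> j)) D)"
    "g_dom (hom_grpd (G (\<U> i \<inter> \<U> j)) D) (snd d (i, j)) = fres G \<rho> (\<U> i \<inter> \<U> j) (\<U> i) (fst d i)"
    "g_cod (hom_grpd (G (\<U> i \<inter> \<U> j)) D) (snd d (i, j)) = fres G \<rho> (\<U> i \<inter> \<U> j) (\<U> j) (fst d j)"
    using assms by (auto simp: desc_grpd_def desc_obj_def)
  then show "snd d (i, j) = (fres G \<rho> (\<U> i \<inter> \<U> j) (\<U> i) (fst d i), fres G \<rho> (\<U> i \<inter> \<U> j) (\<U> j) (fst d j), transition d i j)"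
    "is_nat (G (\<U> i \<inter> \<U> j)) D (fres G \<rho> (\<U> i \<inter> \<U> j) (\<U> i) (fst d i))
      (fres G \<rho> (\<U> i \<inter> \<U> j) (\<U> j) (fst d j)) (transition d i j)"
    unfolding 1 transition_def by (simp_all add: hom_arr)
qed

lemma transition_in_hom:
  assumes "d \<in> g_obj desc" "i \<in> I" "j \<in> I" "x \<in> \<U> i" "x \<in> \<U> j"
  shows "in_hom D (transition d i j x) (fst (fst d i) x) (fst (fst d j) x)"
  using is_natD(1)[OF desc_transition(2)[OF assms(1-3)], of x] assms(4,5) by (simp add: fres_obj)

lemma transition_natural:
  assumes "d \<in> g_obj desc" "i \<in> I" "j \<in> I" and a: "in_hom (G (\<U> i \<inter> \<U> j)) a x y"
  shows "g_comp D (transition d i j y) (snd (fst d i) (snd (\<rho> (\<U> i \<inter> \<U> j) (\<U> i)) a))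
    = g_comp D (snd (fst d j) (snd (\<rho> (\<U> i \<inter> \<U> j) (\<U> j)) a)) (transition d i j x)"
  using is_natD(2)[OF desc_transition(2)[OF assms(1-3)], of a] a by (simp add: fres_arr in_hom_def)

lemma transition_comp:
  assumes d: "d \<in> g_obj desc" and ijk: "i \<in> I" "j \<in> I" "k \<in> I" and x: "x \<in> \<U> i" "x \<in> \<U> j" "x \<in> \<U> k"
  shows "g_comp D (transition d j k x) (transition d i j x) = transition d i k x"
proof -
  let ?W = "\<U> i \<inter> \<U> j \<inter> \<U> k"
  have "g_comp (hom_grpd (G ?W) D) (ares G \<rho> ?W (\<U> j \<inter> \<U> k) (snd d (j, k))) (ares G \<rho> ?W (\<U> i \<inter> \<U> j) (snd d (i, j)))
      = ares G \<rho> ?W (\<U> i \<inter> \<U> k) (snd d (i, k))"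
    using d ijk by (auto simp: desc_grpd_def desc_obj_def)
  from arg_cong[OF this, of "\<lambda>a. hom_component a x"] show ?thesis
    unfolding desc_transition(1)[OF d ijk(1,2)] desc_transition(1)[OF d ijk(2,3)] desc_transition(1)[OF d ijk(1,3)]
    using x by (simp add: ares_simp)
qed

text \<open>The cocycle condition for the triple \<open>i, i, i\<close> makes this arrow idempotent,
  and an idempotent in a groupoid is an identity.\<close>

lemma transition_self:
  assumes "d \<in> g_obj desc" "i \<in> I" "x \<in> \<U> i"
  shows "transition d i i x = g_id D (fst (fst d i) x)"
proof -
  note t = transition_in_hom[OF assms(1,2,2,3,3)]
  show ?thesis
    using comp_cancel_left[OF t in_hom_id t] in_hom_obj[OF t] comp_id_right[OF t]
      transition_comp[OF assms(1,2,2,2,3,3,3)] by simp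
qed

text \<open>Wrapping an arbitrary family of components, cut down to the carriers, hides the nested
  restricted functions. All arrows of \<open>desc\<close> have this form by
  \<open>desc_arrE\<close>, and equations between them become pointwise equations in
  \<open>D\<close>.\<close>

definition desc_arr :: "('i, 'a, 'm, 'c, 'd) descobj \<Rightarrow> ('i, 'a, 'm, 'c, 'd) descobj \<Rightarrow> ('i \<Rightarrow> 'a \<Rightarrow> 'd)
    \<Rightarrow> ('i, 'a, 'm, 'c, 'd) descarr" where
  "desc_arr d e t = (d, e, \<lambda>i\<in>I. (fst d i, fst e i, \<lambda>x\<in>\<U> i. t i x))"

definition is_desc_mor :: "('i, 'a, 'm, 'c, 'd) descobj \<Rightarrow> ('i, 'a, 'm, 'c, 'd) descobj \<Rightarrow> ('i \<Rightarrow> 'a \<Rightarrow> 'd) \<Rightarrow> bool" where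
  "is_desc_mor d e t \<longleftrightarrow> d \<in> g_obj desc \<and> e \<in> g_obj desc \<and>
     (\<forall>i\<in>I. is_nat (G (\<U> i)) D (fst d i) (fst e i) (t i)) \<and>
     (\<forall>i\<in>I. \<forall>j\<in>I. \<forall>x\<in>\<U> i \<inter> \<U> j.
        g_comp D (transition e i j x) (t i x) = g_comp D (t j x) (transition d i j x))"

lemma desc_arr_cong:
  "(\<And>i x. i \<in> I \<Longrightarrow> x \<in> \<U> i \<Longrightarrow> t i x = t' i x) \<Longrightarrow> desc_arr d e t = desc_arr d e t'"
  by (auto simp: desc_arr_def restrict_def fun_eq_iff)

lemma desc_simps [simp]:
  "g_dom desc (desc_arr d e t) = d"
  "g_cod desc (desc_arr d e t) = e"
  "g_id desc d = desc_arr d d (\<lambda>i x. g_id D (fst (fst d i) x))"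
  "g_comp desc (desc_arr e k s) (desc_arr d e t) = desc_arr d k (\<lambda>i x. g_comp D (s i x) (t i x))"
  by (auto simp: desc_grpd_def desc_arr_def split_beta restrict_def fun_eq_iff)

lemma desc_arr_compatible_iff:
  assumes "d \<in> g_obj desc" "e \<in> g_obj desc" "i \<in> I" "j \<in> I"
  shows "g_comp (hom_grpd (G (\<U> i \<inter> \<U> j)) D) (snd e (i, j))
          (ares G \<rho> (\<U> i \<inter> \<U> j) (\<U> i) (fst d i, fst e i, \<lambda>x\<in>\<U> i. t i x))
        = g_comp (hom_grpd (G (\<U> i \<inter> \<U> j)) D)
          (ares G \<rho> (\<U> i \<inter> \<U> j) (\<U> j) (fst d j, fst e j, \<lambda>x\<in>\<U> j. t j x)) (snd d (i, j))
      \<longleftrightarrow> (\<forall>x\<in>\<U> i \<inter> \<U> j. g_comp D (transition e i j x) (t i x) = g_comp D (t j x) (transition d i j x))"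
  unfolding desc_transition(1)[OF assms(1,3,4)] desc_transition(1)[OF assms(2-4)]
  by (auto simp: ares_simp restrict_def fun_eq_iff)

lemma desc_arr_mem_iff: "desc_arr d e t \<in> g_arr desc \<longleftrightarrow> is_desc_mor d e t"
proof -
  have obj_desc: "g_obj desc = desc_obj G \<rho> I \<U> D"
    by (simp add: desc_grpd_def)
  have hom: "(fst d i, fst e i, \<lambda>x\<in>\<U> i. t i x) \<in> g_arr (hom_grpd (G (\<U> i)) D)
      \<longleftrightarrow> is_nat (G (\<U> i)) D (fst d i) (fst e i) (t i)"
    if "d \<in> g_obj desc" "e \<in> g_obj desc" "i \<in> I" for i
    using is_nat_restrict[OF groupoid.is_groupoid[OF groupoid_G[OF open_cover[OF that(3)]]], of D "fst d i" "fst e i" "t i"]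
      desc_functor(1)[OF that(1,3)] desc_functor(1)[OF that(2,3)]
    by (simp add: hom_arr)
  have "desc_arr d e t \<in> g_arr desc \<longleftrightarrow> d \<in> g_obj desc \<and> e \<in> g_obj desc \<and>
      (\<forall>i\<in>I. (fst d i, fst e i, \<lambda>x\<in>\<U> i. t i x) \<in> g_arr (hom_grpd (G (\<U> i)) D)) \<and>
      (\<forall>i\<in>I. \<forall>j\<in>I. g_comp (hom_grpd (G (\<U> i \<inter> \<U> j)) D) (snd e (i, j))
          (ares G \<rho> (\<U> i \<inter> \<U> j) (\<U> i) (fst d i, fst e i, \<lambda>x\<in>\<U> i. t i x))
        = g_comp (hom_grpd (G (\<U> i \<inter> \<U> j)) D)
          (ares G \<rho> (\<U> i \<inter> \<U> j) (\<U> j) (fst d j, fst e j, \<lambda>x\<in>\<U> j. t j x)) (snd d (i, j)))"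
    unfolding obj_desc by (cases d; cases e) (simp add: desc_grpd_def desc_arr_def)
  then show ?thesis
    unfolding is_desc_mor_def using hom desc_arr_compatible_iff by blast
qed

lemma desc_arrE:
  assumes "A \<in> g_arr desc"
  obtains d e t where "A = desc_arr d e t" "is_desc_mor d e t"
proof -
  obtain d e \<theta> where A: "A = (d, e, \<theta>)"
    by (cases A)
  have ext: "\<theta> \<in> extensional I"
    and \<theta>: "\<And>i. i \<in> I \<Longrightarrow> \<theta> i \<in> g_arr (hom_grpd (G (\<U> i)) D)
      \<and> g_dom (hom_grpd (G (\<U> i)) D) (\<theta> i) = fst d i \<and> g_cod (hom_grpd (G (\<U> i)) D) (\<theta> i) = fst e i"
    using assms by (auto simp: A desc_grpd_def)
  have "\<theta> i = (fst d i, fst e i, \<lambda>x\<in>\<U> i. hom_component (\<theta> i) x)" if "i \<in> I" for i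
    using \<theta>[OF that] by (cases "\<theta> i") (auto simp: hom_arr extensional_restrict)
  then have "A = desc_arr d e (\<lambda>i. hom_component (\<theta> i))"
    using ext unfolding A desc_arr_def by (auto simp: extensional_def restrict_def fun_eq_iff)
  with assms show thesis
    using that by (simp add: desc_arr_mem_iff)
qed

section \<open>The canonical functor\<close>

abbreviation hom :: "(('a, 'm, 'c, 'd) gfun, ('a, 'm, 'c, 'd) natarr) grpd" where
  "hom \<equiv> hom_grpd (G U) D"

abbreviation can :: "(('a, 'm, 'c, 'd) gfun, ('a, 'm, 'c, 'd) natarr,
    ('i, 'a, 'm, 'c, 'd) descobj, ('i, 'a, 'm, 'c, 'd) descarr) gfun" where
  "can \<equiv> desc_can G \<rho> I \<U> U D"

lemma groupoid_cover: "i \<in> I \<Longrightarrow> groupoid (G (\<U> i))"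
  by (simp add: groupoid_G open_cover)

lemma functor_id: "is_functor A D F \<Longrightarrow> x \<in> g_obj A \<Longrightarrow> in_hom D (g_id D (fst F x)) (fst F x) (fst F x)"
  by (rule in_hom_id) (simp add: is_functor_def)

lemma is_nat_id:
  assumes "is_groupoid A" "is_functor A D F"
  shows "is_nat A D F F (\<lambda>x. g_id D (fst F x))"
proof -
  interpret A: groupoid A by unfold_locales (rule assms(1))
  have "g_comp D (g_id D (fst F (g_cod A a))) (snd F a) = g_comp D (snd F a) (g_id D (fst F (g_dom A a)))"
    if "a \<in> g_arr A" for a
  proof -
    have "in_hom D (snd F a) (fst F (g_dom A a)) (fst F (g_cod A a))"
      using that by (intro functor_in_hom[OF assms(2)]) (simp add: in_hom_def)
    then show ?thesis
      by (simp add: comp_id_left comp_id_right)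
  qed
  then show ?thesis
    using functor_id[OF assms(2)] by (auto simp: is_nat_def in_hom_def)
qed

lemma hom_arrE:
  assumes "A \<in> g_arr hom"
  obtains F F' \<theta> where "A = (F, F', \<lambda>x\<in>U. \<theta> x)" "F \<in> g_obj hom" "F' \<in> g_obj hom" "is_nat (G U) D F F' \<theta>"
proof -
  obtain F F' \<theta> where A: "A = (F, F', \<theta>)"
    by (cases A)
  with assms have "\<theta> = (\<lambda>x\<in>U. \<theta> x)"
    by (simp add: hom_arr extensional_restrict)
  with A assms show thesis
    using that[of F F' \<theta>] by (simp add: hom_arr)
qed

lemma hom_arrI:
  "F \<in> g_obj hom \<Longrightarrow> F' \<in> g_obj hom \<Longrightarrow> is_nat (G U) D F F' \<theta> \<Longrightarrow> (F, F', \<lambda>x\<in>U. \<theta> x) \<in> g_arr hom"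
  using is_nat_restrict[OF groupoid.is_groupoid[OF groupoid_G[OF open_U]], of D F F' \<theta>] by (simp add: hom_arr)

lemma can_functor: "i \<in> I \<Longrightarrow> fst (fst can F) i = fres G \<rho> (\<U> i) U F"
  by (simp add: desc_can_def desc_can_obj_def)

lemma can_transition: "i \<in> I \<Longrightarrow> j \<in> I \<Longrightarrow> x \<in> \<U> i \<Longrightarrow> x \<in> \<U> j \<Longrightarrow> transition (fst can F) i j x = g_id D (fst F x)"
  by (simp add: desc_can_def desc_can_obj_def transition_def fres_obj)

text \<open>Iterated restrictions of \<open>F\<close> to an open \<open>V\<close> collapse to
  \<open>fres G \<rho> V U F\<close>, so on each overlap the transition is an identity and the
  cocycle condition only composes identities.\<close>

lemma can_obj:
  assumes "F \<in> g_obj hom"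
  shows "fst can F \<in> g_obj desc"
proof -
  have F: "is_functor (G U) D F"
    using assms by (simp add: hom_obj)
  have res: "fres G \<rho> V U F \<in> g_obj (hom_grpd (G V) D)" if "open V" "V \<subseteq> U" for V
    using fres_hom_obj[OF that(1) open_U that(2) F] .
  have int: "\<U> i \<inter> \<U> j \<subseteq> U" "open (\<U> i \<inter> \<U> j)" "\<U> i \<inter> \<U> j \<inter> \<U> k \<subseteq> U" "open (\<U> i \<inter> \<U> j \<inter> \<U> k)"
    if "i \<in> I" "j \<in> I" "k \<in> I" for i j k
    using that sub_U open_cover by (auto intro!: open_Int)
  have ff: "fres G \<rho> V (\<U> i) (fres G \<rho> (\<U> i) U F) = fres G \<rho> V U F" if "i \<in> I" "open V" "V \<subseteq> \<U> i" for V i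
    using fres_fres[OF that(2) open_cover[OF that(1)] open_U that(3) sub_U[OF that(1)]] .
  have ff2: "fres G \<rho> V W (fres G \<rho> W U F) = fres G \<rho> V U F" if "open V" "open W" "V \<subseteq> W" "W \<subseteq> U" for V W
    using fres_fres[OF that(1,2) open_U that(3,4)] .
  have snd_can: "snd (fst can F) (i, j) = (fres G \<rho> (\<U> i \<inter> \<U> j) U F, fres G \<rho> (\<U> i \<inter> \<U> j) U F,
      \<lambda>x\<in>\<U> i \<inter> \<U> j. g_id D (fst F x))" if "i \<in> I" "j \<in> I" for i j
    using that ff[OF that(1) int(2)[OF that that(1)]]
    by (auto simp: desc_can_def desc_can_obj_def fres_obj restrict_def fun_eq_iff)
  have nat: "is_nat (G V) D (fres G \<rho> V U F) (fres G \<rho> V U F) (\<lambda>x\<in>V. g_id D (fst F x))"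
    if "open V" "V \<subseteq> U" for V
  proof -
    note gV = groupoid.is_groupoid[OF groupoid_G[OF that(1)]]
    have "is_nat (G V) D (fres G \<rho> V U F) (fres G \<rho> V U F) (\<lambda>x\<in>V. g_id D (fst (fres G \<rho> V U F) x))"
      using is_nat_restrict[OF gV, of D "fres G \<rho> V U F" "fres G \<rho> V U F" "\<lambda>x. g_id D (fst (fres G \<rho> V U F) x)"]
        is_nat_id[OF gV] res[OF that] by (simp add: hom_obj)
    moreover have "(\<lambda>x\<in>V. g_id D (fst (fres G \<rho> V U F) x)) = (\<lambda>x\<in>V. g_id D (fst F x))"
      by (auto simp: fres_obj)
    ultimately show ?thesis
      by simp
  qed
  have id_id: "g_comp D (g_id D (fst F x)) (g_id D (fst F x)) = g_id D (fst F x)" if "x \<in> U" for x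
    using comp_id_left[OF functor_id[OF F]] that by simp
  have ext: "fst (fst can F) \<in> extensional I" "snd (fst can F) \<in> extensional (I \<times> I)"
    by (simp_all add: desc_can_def desc_can_obj_def)
  have "(fst (fst can F), snd (fst can F)) \<in> desc_obj G \<rho> I \<U> D"
    unfolding desc_obj_def mem_Collect_eq case_prod_conv
  proof (intro conjI ballI ext)
    fix i assume i: "i \<in> I"
    then show "fst (fst can F) i \<in> g_obj (hom_grpd (G (\<U> i)) D)"
      using res open_cover sub_U by (simp add: can_functor)
    fix j assume j: "j \<in> I"
    show "snd (fst can F) (i, j) \<in> g_arr (hom_grpd (G (\<U> i \<inter> \<U> j)) D)"
      unfolding snd_can[OF i j] hom_arr using res nat int i j by simp
    show "g_dom (hom_grpd (G (\<U> i \<inter> \<U> j)) D) (snd (fst can F) (i, j)) = fres G \<rho> (\<U> i \<inter> \<U> j) (\<U> i) (fst (fst can F) i)"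
      "g_cod (hom_grpd (G (\<U> i \<inter> \<U> j)) D) (snd (fst can F) (i, j)) = fres G \<rho> (\<U> i \<inter> \<U> j) (\<U> j) (fst (fst can F) j)"
      unfolding snd_can[OF i j] using i j int by (simp_all add: can_functor ff)
    fix k assume k: "k \<in> I"
    let ?W = "\<U> i \<inter> \<U> j \<inter> \<U> k"
    have W: "open ?W" "?W \<subseteq> U" and x: "x \<in> U" if "x \<in> ?W" for x
      using int i j k that by auto
    have ff3: "fres G \<rho> ?W (\<U> i' \<inter> \<U> j') (fres G \<rho> (\<U> i' \<inter> \<U> j') U F) = fres G \<rho> ?W U F"
      if "i' \<in> I" "j' \<in> I" "?W \<subseteq> \<U> i' \<inter> \<U> j'" for i' j'
      using ff2 int that i j k by metis
    show "g_comp (hom_grpd (G ?W) D) (ares G \<rho> ?W (\<U> j \<inter> \<U> k) (snd (fst can F) (j, k)))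
          (ares G \<rho> ?W (\<U> i \<inter> \<U> j) (snd (fst can F) (i, j)))
        = ares G \<rho> ?W (\<U> i \<inter> \<U> k) (snd (fst can F) (i, k))"
    proof -
      have "?W \<subseteq> \<U> i \<inter> \<U> j" "?W \<subseteq> \<U> j \<inter> \<U> k" "?W \<subseteq> \<U> i \<inter> \<U> k"
        by auto
      note sub = ff3[OF i j this(1)] ff3[OF j k this(2)] ff3[OF i k this(3)]
      show ?thesis
        unfolding snd_can[OF i j] snd_can[OF j k] snd_can[OF i k] ares_simp hom_simps sub
        using id_id sub_U[OF i] by (auto simp: restrict_def fun_eq_iff)
    qed
  qed
  then show ?thesis
    by (simp add: desc_grpd_def)
qed

lemma can_arr: "snd can (F, F', \<lambda>x\<in>U. \<theta> x) = desc_arr (fst can F) (fst can F') (\<lambda>i. \<theta>)"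
proof -
  have "(\<lambda>x\<in>\<U> i. (\<lambda>x\<in>U. \<theta> x) x) = (\<lambda>x\<in>\<U> i. \<theta> x)" if "i \<in> I" for i
    using sub_U[OF that] by (auto simp: restrict_def fun_eq_iff)
  then show ?thesis
    by (auto simp: desc_can_def desc_arr_def desc_can_obj_def ares_simp restrict_def fun_eq_iff)
qed

lemma is_functor_can: "is_functor hom desc can"
  unfolding is_functor_def
proof (intro conjI ballI impI)
  fix F assume F: "F \<in> g_obj hom"
  then show "fst can F \<in> g_obj desc"
    by (rule can_obj)
  have "g_id hom F = (F, F, \<lambda>x\<in>U. g_id D (fst F x))"
    by simp
  then show "snd can (g_id hom F) = g_id desc (fst can F)"
    by (simp only: can_arr desc_simps) (rule desc_arr_cong, simp add: can_functor fres_obj)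
next
  fix A assume "A \<in> g_arr hom"
  then obtain F F' \<theta> where A: "A = (F, F', \<lambda>x\<in>U. \<theta> x)" and F: "F \<in> g_obj hom" "F' \<in> g_obj hom"
    and \<theta>: "is_nat (G U) D F F' \<theta>"
    by (rule hom_arrE)
  have "is_nat (G (\<U> i)) D (fres G \<rho> (\<U> i) U F) (fres G \<rho> (\<U> i) U F') \<theta>" if i: "i \<in> I" for i
    unfolding is_nat_def
  proof (intro conjI ballI)
    fix x assume "x \<in> g_obj (G (\<U> i))"
    then show "\<theta> x \<in> g_arr D" "g_dom D (\<theta> x) = fst (fres G \<rho> (\<U> i) U F) x" "g_cod D (\<theta> x) = fst (fres G \<rho> (\<U> i) U F') x"
      using is_natD(1)[OF \<theta>, of x] sub_U[OF i] by (auto simp: in_hom_def fres_obj)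
  next
    fix a assume a: "a \<in> g_arr (G (\<U> i))"
    note r = rho_arr[OF open_cover[OF i] open_U sub_U[OF i] a]
    show "g_comp D (\<theta> (g_cod (G (\<U> i)) a)) (snd (fres G \<rho> (\<U> i) U F) a)
        = g_comp D (snd (fres G \<rho> (\<U> i) U F') a) (\<theta> (g_dom (G (\<U> i)) a))"
      using is_natD(2)[OF \<theta> r(1)] a by (simp add: fres_arr r)
  qed
  \<comment> \<open>Between canonical data the transitions are identities, so compatibility compares
    \<open>\<theta>\<close> with itself.\<close>
  moreover have "g_comp D (g_id D (fst F' x)) (\<theta> x) = g_comp D (\<theta> x) (g_id D (fst F x))" if "x \<in> U" for x
    using is_natD(1)[OF \<theta>, of x] that by (simp add: comp_id_left comp_id_right)
  then have "g_comp D (g_id D (fst F' x)) (\<theta> x) = g_comp D (\<theta> x) (g_id D (fst F x))" if "x \<in> \<U> i" "i \<in> I" for x i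
    using that sub_U by blast
  ultimately have "is_desc_mor (fst can F) (fst can F') (\<lambda>i. \<theta>)"
    using F by (auto simp: is_desc_mor_def can_obj can_functor can_transition)
  then show "snd can A \<in> g_arr desc" "g_dom desc (snd can A) = fst can (g_dom hom A)"
    "g_cod desc (snd can A) = fst can (g_cod hom A)"
    unfolding A can_arr by (simp_all add: desc_arr_mem_iff)
  fix B assume "B \<in> g_arr hom" and AB: "g_cod hom A = g_dom hom B"
  then obtain F'' \<theta>' where B: "B = (F', F'', \<lambda>x\<in>U. \<theta>' x)"
    by (metis hom_arrE hom_simps(1,2) A)
  have "g_comp hom B A = (F, F'', \<lambda>x\<in>U. g_comp D (\<theta>' x) (\<theta> x))"
    by (auto simp: A B)
  then show "snd can (g_comp hom B A) = g_comp desc (snd can B) (snd can A)"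
    unfolding A B can_arr by (simp only: can_arr desc_simps)
qed

section \<open>Rectification of descent data\<close>

definition chart :: "'a \<Rightarrow> 'i" where
  "chart x = (SOME i. i \<in> I \<and> x \<in> \<U> i)"

lemma chart:
  assumes "x \<in> U"
  shows "chart x \<in> I" "x \<in> \<U> (chart x)"
  using someI_ex[of "\<lambda>i. i \<in> I \<and> x \<in> \<U> i"] assms by (auto simp: chart_def cover)

text \<open>The object value depends on the chart of the point and not on \<open>i\<close>, so
  agreement on objects is built in. The arrow value runs from the chart of the source into member
  \<open>i\<close>, along the given functor, and out to the chart of the target.\<close>

definition rectify :: "('i, 'a, 'm, 'c, 'd) descobj \<Rightarrow> 'i \<Rightarrow> ('a, 'm, 'c, 'd) gfun" where
  "rectify d i = (\<lambda>x. fst (fst d (chart x)) x,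
     \<lambda>a. let x = g_dom (G (\<U> i)) a; y = g_cod (G (\<U> i)) a in
       g_comp D (transition d i (chart y) y) (g_comp D (snd (fst d i) a) (transition d (chart x) i x)))"

lemma rectify_obj: "fst (rectify d i) x = fst (fst d (chart x)) x"
  by (simp add: rectify_def)

lemma rectify_arr:
  "in_hom (G (\<U> i)) a x y \<Longrightarrow> snd (rectify d i) a
    = g_comp D (transition d i (chart y) y) (g_comp D (snd (fst d i) a) (transition d (chart x) i x))"
  by (simp add: rectify_def in_hom_def)

context
  fixes d
  assumes d: "d \<in> g_obj desc"
begin

text \<open>The two transitions are mutually inverse by the cocycle condition for the round trips
  between \<open>i\<close> and \<open>chart x\<close>, since self-transitions are
  identities.\<close>

lemma transition_chart:
  assumes "i \<in> I" "x \<in> \<U> i"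
  shows "in_hom D (transition d (chart x) i x) (fst (fst d (chart x)) x) (fst (fst d i) x)"
    and "in_hom D (transition d i (chart x) x) (fst (fst d i) x) (fst (fst d (chart x)) x)"
    and "g_comp D (transition d (chart x) i x) (transition d i (chart x) x) = g_id D (fst (fst d i) x)"
    and "g_comp D (transition d i (chart x) x) (transition d (chart x) i x) = g_id D (fst (fst d (chart x)) x)"
proof -
  have "x \<in> U"
    using assms sub_U by blast
  note c = chart[OF this]
  show "in_hom D (transition d (chart x) i x) (fst (fst d (chart x)) x) (fst (fst d i) x)"
    "in_hom D (transition d i (chart x) x) (fst (fst d i) x) (fst (fst d (chart x)) x)"
    using transition_in_hom[OF d] c assms by auto
  show "g_comp D (transition d (chart x) i x) (transition d i (chart x) x) = g_id D (fst (fst d i) x)"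
    "g_comp D (transition d i (chart x) x) (transition d (chart x) i x) = g_id D (fst (fst d (chart x)) x)"
    using transition_comp[OF d] transition_self[OF d] c assms by auto
qed

lemma cover_in_hom:
  assumes "i \<in> I" "in_hom (G (\<U> i)) a x y"
  shows "x \<in> \<U> i" "y \<in> \<U> i" "in_hom D (snd (fst d i) a) (fst (fst d i) x) (fst (fst d i) y)"
  using groupoid.in_hom_obj[OF groupoid_cover[OF assms(1)] assms(2)]
    functor_in_hom[OF desc_functor(2)[OF d assms(1)] assms(2)] by simp_all

lemma rectify_in_hom:
  assumes "i \<in> I" "in_hom (G (\<U> i)) a x y"
  shows "in_hom D (snd (rectify d i) a) (fst (fst d (chart x)) x) (fst (fst d (chart y)) y)"
proof -
  note a = cover_in_hom[OF assms]
  show ?thesis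
    unfolding rectify_arr[OF assms(2)]
    by (rule in_hom_comp[OF in_hom_comp[OF transition_chart(1)[OF assms(1) a(1)] a(3)] transition_chart(2)[OF assms(1) a(2)]])
qed

text \<open>The transitions out of the charts are natural from the rectified functor to the given
  one. As they are invertible, this determines the rectified arrows and replaces their definition in
  the cancellation arguments below.\<close>

lemma rectify_natural:
  assumes "i \<in> I" "in_hom (G (\<U> i)) a x y"
  shows "g_comp D (transition d (chart y) i y) (snd (rectify d i) a) = g_comp D (snd (fst d i) a) (transition d (chart x) i x)"
proof -
  note a = cover_in_hom[OF assms]
  note f = in_hom_comp[OF transition_chart(1)[OF assms(1) a(1)] a(3)]
  note c = transition_chart[OF assms(1) a(2)]
  show ?thesis
    using comp_assoc[OF f c(2) c(1)] comp_id_left[OF f] by (simp add: rectify_arr[OF assms(2)] c(3))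
qed

lemma is_functor_rectify:
  assumes i: "i \<in> I"
  shows "is_functor (G (\<U> i)) D (rectify d i)"
  unfolding is_functor_def
proof (intro conjI ballI impI)
  interpret Gi: groupoid "G (\<U> i)"
    using groupoid_cover[OF i] .
  fix x assume "x \<in> g_obj (G (\<U> i))"
  then have x: "x \<in> \<U> i" by simp
  note c = transition_chart[OF i x]
  show "fst (rectify d i) x \<in> g_obj D"
    using in_hom_obj[OF c(1)] by (simp add: rectify_obj)
  have "in_hom (G (\<U> i)) (g_id (G (\<U> i)) x) x x"
    using x by (intro Gi.in_hom_id) simp
  moreover have "snd (fst d i) (g_id (G (\<U> i)) x) = g_id D (fst (fst d i) x)"
    using desc_functor(2)[OF d i] x by (simp add: is_functor_def)
  ultimately show "snd (rectify d i) (g_id (G (\<U> i)) x) = g_id D (fst (rectify d i) x)"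
    using comp_id_left[OF c(1)] by (simp add: rectify_arr rectify_obj c(4))
next
  interpret Gi: groupoid "G (\<U> i)"
    using groupoid_cover[OF i] .
  fix a assume "a \<in> g_arr (G (\<U> i))"
  then obtain x y where a: "in_hom (G (\<U> i)) a x y"
    by (simp add: in_hom_def)
  show "snd (rectify d i) a \<in> g_arr D" "g_dom D (snd (rectify d i) a) = fst (rectify d i) (g_dom (G (\<U> i)) a)"
    "g_cod D (snd (rectify d i) a) = fst (rectify d i) (g_cod (G (\<U> i)) a)"
    using rectify_in_hom[OF i a] a by (simp_all add: in_hom_def rectify_obj)
  fix b assume "b \<in> g_arr (G (\<U> i))" "g_cod (G (\<U> i)) a = g_dom (G (\<U> i)) b"
  then obtain z where b: "in_hom (G (\<U> i)) b y z"
    using a by (simp add: in_hom_def)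
  note ab = Gi.in_hom_comp[OF a b]
  note ra = rectify_in_hom[OF i a] and rb = rectify_in_hom[OF i b]
  note ca = cover_in_hom[OF i a] and cb = cover_in_hom[OF i b]
  note tx = transition_chart[OF i ca(1)] and ty = transition_chart[OF i ca(2)] and tz = transition_chart[OF i cb(2)]
  \<comment> \<open>Composites are compared inside member \<open>i\<close>, that is, after the
    invertible transition from \<open>chart z\<close> to \<open>i\<close>.\<close>
  have "g_comp D (transition d (chart z) i z) (snd (rectify d i) (g_comp (G (\<U> i)) b a))
      = g_comp D (g_comp D (snd (fst d i) b) (snd (fst d i) a)) (transition d (chart x) i x)"
    by (simp add: rectify_natural[OF i ab] functor_comp[OF desc_functor(2)[OF d i] a b])
  also have "\<dots> = g_comp D (snd (fst d i) b) (g_comp D (transition d (chart y) i y) (snd (rectify d i) a))"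
    using comp_assoc[OF tx(1) ca(3) cb(3)] by (simp add: rectify_natural[OF i a])
  also have "\<dots> = g_comp D (g_comp D (transition d (chart z) i z) (snd (rectify d i) b)) (snd (rectify d i) a)"
    using comp_assoc[OF ra ty(1) cb(3)] by (simp add: rectify_natural[OF i b])
  also have "\<dots> = g_comp D (transition d (chart z) i z) (g_comp D (snd (rectify d i) b) (snd (rectify d i) a))"
    by (rule comp_assoc[OF ra rb tz(1)])
  finally show "snd (rectify d i) (g_comp (G (\<U> i)) b a) = g_comp D (snd (rectify d i) b) (snd (rectify d i) a)"
    by (rule comp_cancel_left[OF rectify_in_hom[OF i ab] in_hom_comp[OF ra rb] tz(1)])
qed

text \<open>The transition from \<open>chart y\<close> to \<open>j\<close> factors through
  \<open>i\<close>, and naturality of \<open>transition d i j\<close> carries the arrow from one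
  member to the other; at the source the two transitions recombine into one.\<close>

lemma rectify_agree:
  assumes i: "i \<in> I" and j: "j \<in> I" and "a \<in> g_arr (G (\<U> i \<inter> \<U> j))"
  shows "snd (rectify d i) (snd (\<rho> (\<U> i \<inter> \<U> j) (\<U> i)) a) = snd (rectify d j) (snd (\<rho> (\<U> i \<inter> \<U> j) (\<U> j)) a)"
proof -
  obtain x y where a: "in_hom (G (\<U> i \<inter> \<U> j)) a x y"
    using assms(3) by (simp add: in_hom_def)
  let ?ai = "snd (\<rho> (\<U> i \<inter> \<U> j) (\<U> i)) a" and ?aj = "snd (\<rho> (\<U> i \<inter> \<U> j) (\<U> j)) a"
  have ai: "in_hom (G (\<U> i)) ?ai x y" and aj: "in_hom (G (\<U> j)) ?aj x y"
    using functor_in_hom[OF is_functor_rho[OF open_Int_cover[OF i j] open_cover[OF i]] a]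
      functor_in_hom[OF is_functor_rho[OF open_Int_cover[OF i j] open_cover[OF j]] a] by simp_all
  note ci = cover_in_hom[OF i ai] and cj = cover_in_hom[OF j aj]
  have U: "x \<in> U" "y \<in> U"
    using ci sub_U[OF i] by auto
  note cx = chart[OF U(1)] and cy = chart[OF U(2)]
  note txi = transition_chart[OF i ci(1)] and tyi = transition_chart[OF i ci(2)]
    and tyj = transition_chart[OF j cj(2)]
  note tij = transition_in_hom[OF d i j]
  have "g_comp D (transition d (chart y) j y) (snd (rectify d i) ?ai)
      = g_comp D (g_comp D (transition d i j y) (transition d (chart y) i y)) (snd (rectify d i) ?ai)"
    using transition_comp[OF d cy(1) i j cy(2) ci(2) cj(2)] by simp
  also have "\<dots> = g_comp D (transition d i j y) (g_comp D (snd (fst d i) ?ai) (transition d (chart x) i x))"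
    using comp_assoc[OF rectify_in_hom[OF i ai] tyi(1) tij[OF ci(2) cj(2)]] by (simp add: rectify_natural[OF i ai])
  also have "\<dots> = g_comp D (g_comp D (snd (fst d j) ?aj) (transition d i j x)) (transition d (chart x) i x)"
    using comp_assoc[OF txi(1) ci(3) tij[OF ci(2) cj(2)]] transition_natural[OF d i j a] by simp
  also have "\<dots> = g_comp D (snd (fst d j) ?aj) (transition d (chart x) j x)"
    using comp_assoc[OF txi(1) tij[OF ci(1) cj(1)] cj(3)] transition_comp[OF d cx(1) i j cx(2) ci(1) cj(1)] by simp
  also have "\<dots> = g_comp D (transition d (chart y) j y) (snd (rectify d j) ?aj)"
    by (simp add: rectify_natural[OF j aj])
  finally show ?thesis
    by (rule comp_cancel_left[OF rectify_in_hom[OF i ai] rectify_in_hom[OF j aj] tyj(1)])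
qed

end

section \<open>The quasi-inverse\<close>

definition descend :: "('i, 'a, 'm, 'c, 'd) descobj \<Rightarrow> ('a, 'm, 'c, 'd) gfun" where
  "descend d = (SOME H. H \<in> g_obj hom \<and> (\<forall>i\<in>I. feq (G (\<U> i)) (fcomp H (\<rho> (\<U> i) U)) (rectify d i)))"

lemma descend_exists:
  assumes d: "d \<in> g_obj desc"
  shows "\<exists>H. H \<in> g_obj hom \<and> (\<forall>i\<in>I. feq (G (\<U> i)) (fcomp H (\<rho> (\<U> i) U)) (rectify d i))"
    (is "\<exists>H. ?P H")
proof (rule glue_exists[of "rectify d"])
  show "\<exists>H. ?P H" if "H \<in> g_obj hom" "\<And>i. i \<in> I \<Longrightarrow> feq (G (\<U> i)) (fcomp H (\<rho> (\<U> i) U)) (rectify d i)" for H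
    using that by blast
qed (simp_all only: rectify_obj is_functor_rectify[OF d], rule rectify_agree[OF d])

lemma descend:
  assumes "d \<in> g_obj desc"
  shows "descend d \<in> g_obj hom" "is_functor (G U) D (descend d)"
    "\<And>i. i \<in> I \<Longrightarrow> feq (G (\<U> i)) (fcomp (descend d) (\<rho> (\<U> i) U)) (rectify d i)"
  using someI_ex[OF descend_exists[OF assms], folded descend_def] by (auto simp: hom_obj)

lemma descend_obj:
  assumes "d \<in> g_obj desc" "x \<in> U"
  shows "fst (descend d) x = fst (fst d (chart x)) x"
  using feq_obj[OF descend(3)[OF assms(1) chart(1)[OF assms(2)]], of x] chart(2)[OF assms(2)]
  by (simp add: fcomp_def rectify_obj)

lemma descend_arr:
  assumes "d \<in> g_obj desc" "i \<in> I" "a \<in> g_arr (G (\<U> i))"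
  shows "snd (descend d) (snd (\<rho> (\<U> i) U) a) = snd (rectify d i) a"
  using feq_arr[OF descend(3)[OF assms(1,2)] assms(3)] by (simp add: fcomp_def)

text \<open>For a canonical datum the transitions are identities, so rectifying changes nothing; as
  objects of \<open>hom\<close> are normalised, the result is an equality and not merely an
  isomorphism.\<close>

lemma descend_can:
  assumes F: "F \<in> g_obj hom"
  shows "descend (fst can F) = F"
proof -
  note d = can_obj[OF F]
  have F_fun: "is_functor (G U) D F" "frestr (G U) F = F"
    using F by (simp_all add: hom_obj)
  have "feq (G U) F (descend (fst can F))"
  proof (rule functor_eqI[OF F_fun(1) descend(2)[OF d]])
    fix i assume i: "i \<in> I"
    have obj: "fst F x = fst (descend (fst can F)) x" if "x \<in> \<U> i" for x
      using that sub_U[OF i] chart[of x] by (auto simp: descend_obj[OF d] can_functor fres_obj)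
    have "snd F (snd (\<rho> (\<U> i) U) a) = snd (descend (fst can F)) (snd (\<rho> (\<U> i) U) a)"
      if aG: "a \<in> g_arr (G (\<U> i))" for a
    proof -
      obtain x y where a: "in_hom (G (\<U> i)) a x y"
        using aG by (simp add: in_hom_def)
      have xy: "x \<in> \<U> i" "y \<in> \<U> i" "x \<in> U" "y \<in> U"
        using cover_in_hom(1,2)[OF d i a] sub_U[OF i] by auto
      have Fa: "in_hom D (snd F (snd (\<rho> (\<U> i) U) a)) (fst F x) (fst F y)"
        using functor_in_hom[OF F_fun(1) functor_in_hom[OF is_functor_rho[OF open_cover[OF i] open_U sub_U[OF i]] a]]
        by simp
      have "snd (rectify (fst can F) i) a = snd F (snd (\<rho> (\<U> i) U) a)"
        using xy chart i that comp_id_left[OF Fa] comp_id_right[OF Fa]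
        by (simp add: rectify_arr[OF a] can_transition can_functor fres_arr)
      then show ?thesis
        by (simp add: descend_arr[OF d i that])
    qed
    with obj show "feq (G (\<U> i)) (fcomp F (\<rho> (\<U> i) U)) (fcomp (descend (fst can F)) (\<rho> (\<U> i) U))"
      by (simp add: feq_def fcomp_def)
  qed
  then have "frestr (G U) F = frestr (G U) (descend (fst can F))"
    by (simp add: frestr_eq_iff)
  then show ?thesis
    using F_fun(2) descend(1)[OF d] by (simp add: hom_obj)
qed

text \<open>At a point the component in its chart is the one that fits, because
  \<open>descend\<close> takes its object values there.\<close>

definition quasi_inverse :: "(('i, 'a, 'm, 'c, 'd) descobj, ('i, 'a, 'm, 'c, 'd) descarr,
    ('a, 'm, 'c, 'd) gfun, ('a, 'm, 'c, 'd) natarr) gfun" where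
  "quasi_inverse = (descend, \<lambda>(d, e, \<theta>). (descend d, descend e, \<lambda>x\<in>U. hom_component (\<theta> (chart x)) x))"

lemma quasi_inverse_arr: "snd quasi_inverse (desc_arr d e t) = (descend d, descend e, \<lambda>x\<in>U. t (chart x) x)"
  using chart by (auto simp: quasi_inverse_def desc_arr_def restrict_def fun_eq_iff)

lemma is_desc_morD:
  assumes "is_desc_mor d e t" "i \<in> I"
  shows "d \<in> g_obj desc" "e \<in> g_obj desc" "is_nat (G (\<U> i)) D (fst d i) (fst e i) (t i)"
    "x \<in> \<U> i \<Longrightarrow> in_hom D (t i x) (fst (fst d i) x) (fst (fst e i) x)"
    "j \<in> I \<Longrightarrow> x \<in> \<U> i \<Longrightarrow> x \<in> \<U> j
      \<Longrightarrow> g_comp D (transition e i j x) (t i x) = g_comp D (t j x) (transition d i j x)"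
proof -
  show nat: "is_nat (G (\<U> i)) D (fst d i) (fst e i) (t i)"
    using assms by (simp add: is_desc_mor_def)
  show "in_hom D (t i x) (fst (fst d i) x) (fst (fst e i) x)" if "x \<in> \<U> i"
    using is_natD(1)[OF nat] that by simp
qed (use assms in \<open>auto simp: is_desc_mor_def\<close>)

text \<open>By \<open>is_natI_local\<close> it suffices to treat arrows of one member
  \<open>i\<close>. The square is transported there, where \<open>t i\<close> is natural;
  compatibility of \<open>t\<close> with the transitions passes between the charts and
  \<open>i\<close> at both ends.\<close>

lemma descend_natural:
  assumes t: "is_desc_mor d e t"
  shows "is_nat (G U) D (descend d) (descend e) (\<lambda>x. t (chart x) x)"
proof (rule is_natI_local)
  have d: "d \<in> g_obj desc" and e: "e \<in> g_obj desc"
    using t by (auto simp: is_desc_mor_def)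
  show "is_functor (G U) D (descend d)" "is_functor (G U) D (descend e)"
    using d e by (auto intro: descend)
  show "in_hom D (t (chart x) x) (fst (descend d) x) (fst (descend e) x)" if "x \<in> U" for x
    using is_desc_morD(4)[OF t chart[OF that]] by (simp add: descend_obj[OF d that] descend_obj[OF e that])
  fix i a assume i: "i \<in> I" and "a \<in> g_arr (G (\<U> i))"
  then obtain x y where a: "in_hom (G (\<U> i)) a x y" and a': "a \<in> g_arr (G (\<U> i))"
    by (simp add: in_hom_def)
  note cd = cover_in_hom[OF d i a] and ce = cover_in_hom[OF e i a]
  have U: "x \<in> U" "y \<in> U"
    using cd sub_U[OF i] by auto
  note cx = chart[OF U(1)] and cy = chart[OF U(2)]
  note ti = is_desc_morD(4)[OF t i]
  note td = is_desc_morD(4)[OF t cx] and ty = is_desc_morD(4)[OF t cy]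
  note dx = transition_chart[OF d i cd(1)] and dy = transition_chart[OF d i cd(2)]
    and ex = transition_chart[OF e i cd(1)] and ey = transition_chart[OF e i cd(2)]
  note rd = rectify_in_hom[OF d i a] and re = rectify_in_hom[OF e i a]
  \<comment> \<open>Both sides are composed with the transition from \<open>chart y\<close> to
    \<open>i\<close>, which is cancelled at the end.\<close>
  have "g_comp D (transition e (chart y) i y) (g_comp D (t (chart y) y) (snd (rectify d i) a))
      = g_comp D (g_comp D (t i y) (transition d (chart y) i y)) (snd (rectify d i) a)"
    using comp_assoc[OF rd ty ey(1)] is_desc_morD(5)[OF t cy(1) i cy(2) cd(2)] by simp
  also have "\<dots> = g_comp D (t i y) (g_comp D (snd (fst d i) a) (transition d (chart x) i x))"
    using comp_assoc[OF rd dy(1) ti[OF cd(2)]] by (simp add: rectify_natural[OF d i a])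
  also have "\<dots> = g_comp D (g_comp D (snd (fst e i) a) (t i x)) (transition d (chart x) i x)"
    using comp_assoc[OF dx(1) cd(3) ti[OF cd(2)]] is_natD(2)[OF is_desc_morD(3)[OF t i] a'] a
    by (simp add: in_hom_def)
  also have "\<dots> = g_comp D (snd (fst e i) a) (g_comp D (transition e (chart x) i x) (t (chart x) x))"
    using comp_assoc[OF dx(1) ti[OF cd(1)] ce(3)] is_desc_morD(5)[OF t cx(1) i cx(2) cd(1)] by simp
  also have "\<dots> = g_comp D (g_comp D (transition e (chart y) i y) (snd (rectify e i) a)) (t (chart x) x)"
    using comp_assoc[OF td ex(1) ce(3)] by (simp add: rectify_natural[OF e i a])
  also have "\<dots> = g_comp D (transition e (chart y) i y) (g_comp D (snd (rectify e i) a) (t (chart x) x))"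
    by (rule comp_assoc[OF td re ey(1)])
  finally have "g_comp D (t (chart y) y) (snd (rectify d i) a) = g_comp D (snd (rectify e i) a) (t (chart x) x)"
    by (rule comp_cancel_left[OF in_hom_comp[OF rd ty] in_hom_comp[OF td re] ey(1)])
  then show "g_comp D (t (chart (g_cod (G (\<U> i)) a)) (g_cod (G (\<U> i)) a)) (snd (descend d) (snd (\<rho> (\<U> i) U) a))
      = g_comp D (snd (descend e) (snd (\<rho> (\<U> i) U) a)) (t (chart (g_dom (G (\<U> i)) a)) (g_dom (G (\<U> i)) a))"
    using a by (simp add: descend_arr[OF d i a'] descend_arr[OF e i a'] in_hom_def)
qed

lemma is_functor_quasi_inverse: "is_functor desc hom quasi_inverse"
  unfolding is_functor_def
proof (intro conjI ballI impI)
  fix d assume d: "d \<in> g_obj desc"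
  then show "fst quasi_inverse d \<in> g_obj hom"
    by (simp add: quasi_inverse_def descend)
  show "snd quasi_inverse (g_id desc d) = g_id hom (fst quasi_inverse d)"
    unfolding desc_simps quasi_inverse_arr
    by (auto simp: quasi_inverse_def descend_obj[OF d])
next
  fix A assume "A \<in> g_arr desc"
  then obtain d e t where A: "A = desc_arr d e t" and t: "is_desc_mor d e t"
    by (rule desc_arrE)
  have "descend d \<in> g_obj hom" "descend e \<in> g_obj hom"
    using t by (auto simp: is_desc_mor_def intro: descend)
  then show "snd quasi_inverse A \<in> g_arr hom"
    unfolding A quasi_inverse_arr by (intro hom_arrI descend_natural[OF t])
  show "g_dom hom (snd quasi_inverse A) = fst quasi_inverse (g_dom desc A)"
    "g_cod hom (snd quasi_inverse A) = fst quasi_inverse (g_cod desc A)"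
    unfolding A quasi_inverse_arr by (simp_all add: quasi_inverse_def)
  fix B assume "B \<in> g_arr desc" and AB: "g_cod desc A = g_dom desc B"
  then obtain k s where B: "B = desc_arr e k s"
    by (metis desc_arrE desc_simps(1,2) A)
  show "snd quasi_inverse (g_comp desc B A) = g_comp hom (snd quasi_inverse B) (snd quasi_inverse A)"
    unfolding A B desc_simps quasi_inverse_arr by auto
qed

section \<open>Unit and counit\<close>

definition counit :: "('i, 'a, 'm, 'c, 'd) descobj \<Rightarrow> ('i, 'a, 'm, 'c, 'd) descarr" where
  "counit d = desc_arr (fst can (descend d)) d (\<lambda>i x. transition d (chart x) i x)"

text \<open>Naturality in member \<open>i\<close> is \<open>rectify_natural\<close>. Compatibility
  on an overlap is the cocycle condition for \<open>chart x\<close>, \<open>i\<close>,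
  \<open>j\<close>, the transitions of the canonical datum being identities.\<close>

lemma counit_mor:
  assumes d: "d \<in> g_obj desc"
  shows "is_desc_mor (fst can (descend d)) d (\<lambda>i x. transition d (chart x) i x)"
  unfolding is_desc_mor_def
proof (intro conjI ballI)
  show "fst can (descend d) \<in> g_obj desc" "d \<in> g_obj desc"
    using d can_obj descend by auto
next
  fix i assume i: "i \<in> I"
  show "is_nat (G (\<U> i)) D (fst (fst can (descend d)) i) (fst d i) (\<lambda>x. transition d (chart x) i x)"
    unfolding is_nat_def
  proof (intro conjI ballI)
    fix x assume "x \<in> g_obj (G (\<U> i))"
    then have x: "x \<in> \<U> i" "x \<in> U"
      using sub_U[OF i] by auto
    then show "transition d (chart x) i x \<in> g_arr D"
      "g_dom D (transition d (chart x) i x) = fst (fst (fst can (descend d)) i) x"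
      "g_cod D (transition d (chart x) i x) = fst (fst d i) x"
      using transition_chart(1)[OF d i x(1)]
      by (simp_all add: in_hom_def can_functor[OF i] fres_obj descend_obj[OF d])
  next
    fix a assume a: "a \<in> g_arr (G (\<U> i))"
    then show "g_comp D (transition d (chart (g_cod (G (\<U> i)) a)) i (g_cod (G (\<U> i)) a)) (snd (fst (fst can (descend d)) i) a)
        = g_comp D (snd (fst d i) a) (transition d (chart (g_dom (G (\<U> i)) a)) i (g_dom (G (\<U> i)) a))"
      using rectify_natural[OF d i, of a "g_dom (G (\<U> i)) a" "g_cod (G (\<U> i)) a"]
      by (simp add: in_hom_def can_functor[OF i] fres_arr descend_arr[OF d i a])
  qed
  fix j x assume j: "j \<in> I" and x: "x \<in> \<U> i \<inter> \<U> j"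
  then have xU: "x \<in> U"
    using sub_U[OF i] by auto
  show "g_comp D (transition d i j x) (transition d (chart x) i x)
      = g_comp D (transition d (chart x) j x) (transition (fst can (descend d)) i j x)"
    using x i j transition_comp[OF d chart(1)[OF xU] i j chart(2)[OF xU]]
      comp_id_right[OF transition_chart(1)[OF d j, of x]]
    by (simp add: can_transition descend_obj[OF d xU])
qed

text \<open>At a point \<open>x\<close> of member \<open>i\<close> the square is the compatibility
  of \<open>t\<close> with the transition from \<open>chart x\<close> to \<open>i\<close>.\<close>

lemma is_nat_counit: "is_nat desc desc (fcomp can quasi_inverse) fident counit"
  unfolding is_nat_def
proof (intro conjI ballI)
  fix d assume d: "d \<in> g_obj desc"
  show "counit d \<in> g_arr desc" "g_dom desc (counit d) = fst (fcomp can quasi_inverse) d"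
    "g_cod desc (counit d) = fst fident d"
    using counit_mor[OF d]
    by (simp_all add: counit_def desc_arr_mem_iff fcomp_def quasi_inverse_def fident_def)
next
  fix A assume "A \<in> g_arr desc"
  then obtain d e t where A: "A = desc_arr d e t" and t: "is_desc_mor d e t"
    by (rule desc_arrE)
  have "g_comp desc (counit e) (snd can (snd quasi_inverse A))
      = desc_arr (fst can (descend d)) e (\<lambda>i x. g_comp D (transition e (chart x) i x) (t (chart x) x))"
    unfolding A quasi_inverse_arr can_arr counit_def desc_simps ..
  also have "\<dots> = desc_arr (fst can (descend d)) e (\<lambda>i x. g_comp D (t i x) (transition d (chart x) i x))"
  proof (rule desc_arr_cong)
    fix i x assume i: "i \<in> I" and x: "x \<in> \<U> i"
    have "x \<in> U"
      using x sub_U[OF i] by auto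
    note c = chart[OF this]
    show "g_comp D (transition e (chart x) i x) (t (chart x) x) = g_comp D (t i x) (transition d (chart x) i x)"
      by (rule is_desc_morD(5)[OF t c(1) i c(2) x])
  qed
  also have "\<dots> = g_comp desc A (counit d)"
    unfolding A counit_def desc_simps ..
  finally show "g_comp desc (counit (g_cod desc A)) (snd (fcomp can quasi_inverse) A)
      = g_comp desc (snd fident A) (counit (g_dom desc A))"
    by (simp add: A fcomp_def fident_def)
qed

text \<open>The components of \<open>snd can A\<close> do not depend on the index, so evaluating
  them in charts returns \<open>A\<close>; together with \<open>descend_can\<close> the round trip
  is strictly the identity, also on arrows.\<close>

lemma is_nat_unit: "is_nat hom hom fident (fcomp quasi_inverse can) (g_id hom)"
  unfolding is_nat_def
proof (intro conjI ballI)
  fix F assume F: "F \<in> g_obj hom"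
  then have "is_functor (G U) D F"
    by (simp add: hom_obj)
  then show "g_id hom F \<in> g_arr hom"
    using hom_arrI[OF F F is_nat_id] groupoid.is_groupoid[OF groupoid_G[OF open_U]] by simp
  show "g_dom hom (g_id hom F) = fst fident F" "g_cod hom (g_id hom F) = fst (fcomp quasi_inverse can) F"
    using descend_can[OF F] by (simp_all add: fident_def fcomp_def quasi_inverse_def)
next
  fix A assume "A \<in> g_arr hom"
  then obtain F F' \<theta> where A: "A = (F, F', \<lambda>x\<in>U. \<theta> x)" and F: "F \<in> g_obj hom" "F' \<in> g_obj hom"
    and \<theta>: "is_nat (G U) D F F' \<theta>"
    by (rule hom_arrE)
  have "g_comp D (g_id D (fst F' x)) (\<theta> x) = g_comp D (\<theta> x) (g_id D (fst F x))" if "x \<in> U" for x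
    using is_natD(1)[OF \<theta>, of x] that by (simp add: comp_id_left comp_id_right)
  moreover have "snd (fcomp quasi_inverse can) A = A"
    by (simp add: A fcomp_def can_arr quasi_inverse_arr descend_can F)
  ultimately show "g_comp hom (g_id hom (g_cod hom A)) (snd fident A)
      = g_comp hom (snd (fcomp quasi_inverse can) A) (g_id hom (g_dom hom A))"
    by (auto simp: A fident_def restrict_def fun_eq_iff)
qed

lemma is_equivalence_can: "is_equivalence hom desc can"
  unfolding is_equivalence_def
  using is_functor_can is_functor_quasi_inverse is_nat_unit is_nat_counit by blast

end

text \<open>The cosheaf property is applied to the given cover and to \<open>D\<close> only, which
  is why the index type and the types of the test groupoids are the same in hypothesis and
  conclusion.\<close>

lemma is_costack_if_is_cosheaf:
  fixes G :: "'a::topological_space set \<Rightarrow> ('a, 'm) grpd"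
  assumes "is_open_grpd_functor G \<rho>" "is_cosheaf G \<rho> TYPE('i) TYPE('c \<times> 'd)"
    and "\<And>V. g_obj (G V) = V" "\<And>V W x. fst (\<rho> V W) x = x"
  shows "is_costack G \<rho> TYPE('i) TYPE('c \<times> 'd)"
  unfolding is_costack_def
proof (intro allI impI)
  fix U and I :: "'i set" and \<U> :: "'i \<Rightarrow> 'a set" and D :: "('c, 'd) grpd"
  assume "open U \<and> (\<forall>i\<in>I. open (\<U> i)) \<and> U = (\<Union>i\<in>I. \<U> i) \<and> is_groupoid D"
  then interpret descent D G \<rho> I \<U> U
    using assms by unfold_locales auto
  show "is_equivalence (hom_grpd (G U) D) (desc_grpd G \<rho> I \<U> D) (desc_can G \<rho> I \<U> U D)"
    by (rule is_equivalence_can)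
qed

theorem theorem3p2:
  shows "is_open_grpd_functor (Pi1 :: 'a::topological_space set \<Rightarrow> _) Pi1_incl \<and>
         is_cosheaf (Pi1 :: 'a set \<Rightarrow> _) Pi1_incl TYPE('i) TYPE('c \<times> 'd) \<and>
         is_costack (Pi1 :: 'a set \<Rightarrow> _) Pi1_incl TYPE('i) TYPE('c \<times> 'd)"
  by (intro conjI is_open_grpd_functor_Pi1 is_cosheaf_Pi1 is_costack_if_is_cosheaf Pi1_obj fst_Pi1_incl)

end
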